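(* For each integer $n \ge 1$, the bivariate polynomial \[ \sum_{\sigma \in H(5) \cap S_n} s^{\mathrm{des}(\sigma)} t^{\mathrm{ides}(\sigma)} \] is gamma-positive (as a bivariate palindromic polynomial of darga $n-1$); here $H(5)$ is the substitution closure of the set of all simple permutations of length at most $5$.
   Context: For $\pi \in S_n$ (written in one-line notation), $\mathrm{des}(\pi)=|\{i\in\{1,\dots,n-1\} : \pi(i)>\pi(i+1)\}|$ and $\mathrm{ides}(\pi)=\mathrm{des}(\pi^{-1})$. A block of a permutation $a_1\ldots a_n$ is a nonempty contiguous sequence of entries $a_i a_{i+1}\ldots a_{i+k}$ whose values also form a contiguous sequence of integers. Singletons and the whole permutation are trivial blocks; all other blocks are proper. A permutation is simple if it has no proper blocks (so $1$, $12$, $21$ are simple). $\mathrm{Simp}_{\le n}$ is the set of all simple permutations of length at most $n$. Inflation: for $\pi\in S_k$ and $\alpha_i\in S_{n_i}$ $(1\le i\le k)$, with $n_1,\dots,n_k$ positive integers of sum $n$, $\pi[\alpha_1,\dots,\alpha_k]\in S_n$ is the permutation obtained by replacing the $i$-th entry of $\pi$ by a block order-isomorphic to $\alpha_i$ on the values $\{s_i+1,\dots,s_i+n_i\}$, where $s_i=\sum_{j:\,\pi(j)<\pi(i)} n_j$ (so the relative order of the blocks is that of $\pi$). For example $2413[213,21,132,1]=546\,98\,132\,7$. For sets of permutations $\mathcal A,\mathcal B$, $\mathcal A[\mathcal B]=\{\alpha[\beta_1,\dots,\beta_k] : \alpha\in\mathcal A \text{ of length } k,\ \beta_1,\dots,\beta_k\in\mathcal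 B\}$. A set $C$ of permutations is substitution-closed if $C=C[C]$; the substitution closure $\langle C\rangle$ is the smallest substitution-closed set of permutations containing $C$. $H(n)=\langle \mathrm{Simp}_{\le n}\rangle$. A bivariate polynomial $f(s,t)$ is palindromic of darga $n-1$ if $f(s,t)=(st)^{n-1}f(1/s,1/t)$ and $f(s,t)=f(t,s)$. These polynomials form a vector space with basis (the bivariate gamma basis) $\{(st)^i(s+t)^j(1+st)^{n-1-j-2i} : i,j\ge 0,\ 2i+j\le n-1\}$. Such a polynomial is gamma-positive if all its coefficients in this basis are nonnegative. *)

theory Defs
  imports "HOL-Combinatorics.Multiset_Permutations" "HOL-Computational_Algebra.Polynomial"
begin

text \<open>
  A permutation of length \<open>n\<close> is its one-line notation, a list in \<open>permutations_of_set {1..n}\<close>.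
  List positions count from 0, the entries from 1.
\<close>

abbreviation Sym :: "nat \<Rightarrow> nat list set" where
  "Sym n \<equiv> permutations_of_set {1..n}"

text \<open>The empty permutation is excluded, since the parts of an inflation have positive length.\<close>

definition all_perms :: "nat list set" where
  "all_perms = (\<Union>n\<in>{1..}. Sym n)"

definition des :: "nat list \<Rightarrow> nat" where
  "des w = card {i. Suc i < length w \<and> w ! i > w ! Suc i}"

definition inv_perm :: "nat list \<Rightarrow> nat list" where
  "inv_perm w = map (\<lambda>v. Suc (THE i. i < length w \<and> w ! i = v)) [1..<Suc (length w)]"

definition ides :: "nat list \<Rightarrow> nat" where
  "ides w = des (inv_perm w)"

text \<open>The \<open>m\<close> entries of \<open>w\<close> starting at position \<open>i\<close> form a block.\<close>

definition is_block :: "nat list \<Rightarrow> nat \<Rightarrow> nat \<Rightarrow> bool" where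
  "is_block w i m \<longleftrightarrow>
     m \<ge> 1 \<and> i + m \<le> length w \<and> (\<exists>a b. set (take m (drop i w)) = {a..b})"

definition simple_perm :: "nat list \<Rightarrow> bool" where
  "simple_perm w \<longleftrightarrow>
     w \<in> all_perms \<and> (\<forall>i m. is_block w i m \<longrightarrow> m = 1 \<or> m = length w)"

definition Simp_le :: "nat \<Rightarrow> nat list set" where
  "Simp_le n = {w. simple_perm w \<and> length w \<le> n}"

text \<open>The inner sum is the total length of the blocks whose values lie below the \<open>i\<close>-th block.\<close>

definition inflate :: "nat list \<Rightarrow> nat list list \<Rightarrow> nat list" where
  "inflate p as =
     concat (map (\<lambda>i. map (\<lambda>x. (\<Sum>j | j < length p \<and> p ! j < p ! i. length (as ! j)) + x) (as ! i))
       [0..<length p])"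

definition inflations :: "nat list set \<Rightarrow> nat list set \<Rightarrow> nat list set" where
  "inflations A B = {inflate a bs | a bs. a \<in> A \<and> length bs = length a \<and> set bs \<subseteq> B}"

definition subst_closed :: "nat list set \<Rightarrow> bool" where
  "subst_closed C \<longleftrightarrow> C \<subseteq> all_perms \<and> C = inflations C C"

definition subst_closure :: "nat list set \<Rightarrow> nat list set" where
  "subst_closure C = \<Inter>{D. subst_closed D \<and> C \<subseteq> D}"

definition H :: "nat \<Rightarrow> nat list set" where
  "H n = subst_closure (Simp_le n)"

text \<open>
  Bivariate real polynomials are elements of \<open>\<real>[s][t]\<close>: the outer variable is \<open>t\<close>,
  and the coefficients are polynomials in \<open>s\<close>.
\<close>

definition S_var :: "real poly poly" where
  "S_var = [:[:0, 1:]:]"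

definition T_var :: "real poly poly" where
  "T_var = [:0, 1:]"

definition eval2 :: "real poly poly \<Rightarrow> real \<Rightarrow> real \<Rightarrow> real" where
  "eval2 f s t = poly (poly f [:t:]) s"

text \<open>
  The two identities between (rational) functions in \<open>s, t\<close> are stated pointwise,
  which over the reals is the same as an identity of rational functions.
\<close>

definition palindromic :: "nat \<Rightarrow> real poly poly \<Rightarrow> bool" where
  "palindromic d f \<longleftrightarrow>
     (\<forall>s t. s \<noteq> 0 \<longrightarrow> t \<noteq> 0 \<longrightarrow> eval2 f s t = (s * t) ^ d * eval2 f (1 / s) (1 / t)) \<and>
     (\<forall>s t. eval2 f s t = eval2 f t s)"

definition gamma_basis :: "nat \<Rightarrow> nat \<Rightarrow> nat \<Rightarrow> real poly poly" where
  "gamma_basis d i j =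
     (S_var * T_var) ^ i * (S_var + T_var) ^ j * (1 + S_var * T_var) ^ (d - j - 2 * i)"

text \<open>
  The gamma basis is linearly independent, so \<open>\<gamma>\<close> is the unique family of coefficients of \<open>f\<close>.
  Multiplication by the scalar \<open>c\<close> is multiplication by the constant polynomial \<open>[:[:c:]:]\<close>.
\<close>

definition gamma_positive :: "nat \<Rightarrow> real poly poly \<Rightarrow> bool" where
  "gamma_positive d f \<longleftrightarrow> palindromic d f \<and>
     (\<exists>\<gamma> :: nat \<Rightarrow> nat \<Rightarrow> real.
        (\<forall>i j. 2 * i + j \<le> d \<longrightarrow> \<gamma> i j \<ge> 0) \<and>
        f = (\<Sum>(i, j) | 2 * i + j \<le> d. [:[:\<gamma> i j:]:] * gamma_basis d i j))"

end

theory Submission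
  imports Defs "HOL-Computational_Algebra.Formal_Power_Series"
begin

text \<open>
  Every permutation of length at least \<open>2\<close> in \<open>H(5)\<close> is either a sum \<open>12[\<alpha>,\<beta>]\<close> with \<open>\<alpha>\<close> not a sum,
  or a skew sum \<open>21[\<alpha>,\<beta>]\<close> with \<open>\<alpha>\<close> not a skew sum, or an inflation of a simple permutation of length
  \<open>4\<close> or \<open>5\<close>, and this decomposition is unique. Since \<open>des\<close> and \<open>ides\<close> are additive under inflation,
  the generating function \<open>F = \<Sum>\<sigma>. x ^ |\<sigma>| s ^ des \<sigma> t ^ ides \<sigma>\<close> satisfies, with \<open>p = st\<close> and
  \<open>q = s + t\<close>,
  \<open>F = x + A + B + S\<close>, \<open>A = (F - A) F\<close>, \<open>B = p (F - B) F\<close>, \<open>S = p q F\<^sup>4 + 6 p\<^sup>2 F\<^sup>5\<close>.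
  Eliminating \<open>A\<close> and \<open>B\<close> gives
  \<open>F = p F\<^sup>3 + (1 + (1 + p) F + p F\<^sup>2) (x + S)\<close>,
  which has no negative signs. As \<open>p\<close>, \<open>q\<close>, \<open>1 + p\<close> are the generators of the gamma basis, of darga
  \<open>2\<close>, \<open>1\<close>, \<open>1\<close>, the coefficients of \<open>F\<close> are gamma-positive by induction on \<open>n\<close>.
\<close>

section \<open>Inflations as concatenations\<close>

text \<open>Taken alone, the equations for \<open>A\<close> and \<open>B\<close> give
  \<open>A = F\<^sup>2 / (1 + F)\<close> and \<open>B = p F\<^sup>2 / (1 + p F)\<close>, whose
  expansions alternate in sign, so the decomposition does not show positivity directly. Multiplying
  \<open>F - A - B = x + S\<close> by \<open>(1 + F) (1 + p F) = 1 + (1 + p) F + p F\<^sup>2\<close>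
  clears both denominators. On the left everything negative cancels except
  \<open>- p F\<^sup>3\<close>, which moves to the other side.

  The dargas then fit exactly. If the coefficient of \<open>x ^ m\<close> in \<open>F\<close> has
  darga \<open>m - 1\<close>, then in \<open>F ^ k\<close> it has darga \<open>m - k\<close>, and
  each of \<open>p F\<^sup>3\<close>, \<open>p q F\<^sup>4\<close>,
  \<open>p\<^sup>2 F\<^sup>5\<close> is brought back to \<open>m - 1\<close>. The constants in
  \<open>S\<close> are weights: 2413 and 3142 contribute \<open>s t\<^sup>2\<close> and
  \<open>s\<^sup>2 t\<close>, with sum \<open>p q\<close>, and each of the six simple permutations
  of length 5 contributes \<open>s\<^sup>2 t\<^sup>2\<close>.\<close>

lemma in_set_concat_nth: "x \<in> set (concat ws) \<longleftrightarrow> (\<exists>i<length ws. x \<in> set (ws ! i))"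
  by (metis UN_iff in_set_conv_nth set_concat)

text \<open>Inflation up to relative order: the parts need be neither standardised nor intervals of
  values. That they are intervals follows once their concatenation is a permutation, see
  \<open>inflate_of_ordered_like\<close>.\<close>

definition ordered_like :: "nat list \<Rightarrow> nat list list \<Rightarrow> bool" where
  "ordered_like p ws \<longleftrightarrow> length ws = length p \<and>
     (\<forall>i<length p. \<forall>j<length p. p ! i < p ! j \<longrightarrow> (\<forall>x\<in>set (ws ! i). \<forall>y\<in>set (ws ! j). x < y))"

lemma ordered_likeD:
  assumes "ordered_like p ws" "i < length p" "j < length p" "p ! i < p ! j"
    "x \<in> set (ws ! i)" "y \<in> set (ws ! j)"
  shows "x < y"
  using assms unfolding ordered_like_def by blast

lemma ordered_like_Cons:
  assumes "ordered_like (a # p) (u # ws)"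
  shows "ordered_like p ws"
  unfolding ordered_like_def
proof (intro conjI allI impI ballI)
  show "length ws = length p" using assms by (simp add: ordered_like_def)
  fix i j x y assume "i < length p" "j < length p" "p ! i < p ! j" "x \<in> set (ws ! i)" "y \<in> set (ws ! j)"
  then show "x < y" using ordered_likeD[OF assms, of "Suc i" "Suc j" x y] by simp
qed

lemma ordered_like_disjoint:
  assumes "ordered_like p ws" "distinct p" "i < length p" "j < length p" "i \<noteq> j"
  shows "set (ws ! i) \<inter> set (ws ! j) = {}"
proof -
  have "p ! i < p ! j \<or> p ! j < p ! i"
    using assms by (meson nth_eq_iff_index_eq linorder_neqE_nat)
  then show ?thesis
    using ordered_likeD[OF assms(1,3,4)] ordered_likeD[OF assms(1,4,3)] by fastforce
qed

lemma ordered_like_less_iff: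
  assumes "ordered_like p ws" "distinct p" "i < length p" "j < length p" "i \<noteq> j"
    "x \<in> set (ws ! i)" "y \<in> set (ws ! j)"
  shows "x < y \<longleftrightarrow> p ! i < p ! j"
proof -
  have "p ! i < p ! j \<or> p ! j < p ! i"
    using assms by (meson nth_eq_iff_index_eq linorder_neqE_nat)
  then show ?thesis
    using ordered_likeD[OF assms(1,3,4)] ordered_likeD[OF assms(1,4,3)] assms(6,7) by fastforce
qed

lemma ordered_like_distinct:
  assumes "ordered_like p ws" "distinct p" "\<And>w. w \<in> set ws \<Longrightarrow> distinct w"
  shows "distinct (concat ws)"
  using assms
proof (induction p arbitrary: ws)
  case Nil
  then show ?case by (simp add: ordered_like_def)
next
  case (Cons a p)
  obtain u us where ws: "ws = u # us"
    using Cons.prems(1) by (cases ws) (auto simp: ordered_like_def)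
  have len: "length us = length p" using Cons.prems(1) ws by (simp add: ordered_like_def)
  have "set u \<inter> set v = {}" if v: "v \<in> set us" for v
  proof -
    obtain j where "j < length p" "v = us ! j" using v len by (metis in_set_conv_nth)
    then show ?thesis
      using ordered_like_disjoint[OF Cons.prems(1,2), of 0 "Suc j"] ws by simp
  qed
  moreover have "distinct (concat us)"
    using Cons.IH[OF ordered_like_Cons] Cons.prems ws by auto
  ultimately show ?case using Cons.prems(3) ws by auto
qed

lemma Sym_iff: "w \<in> Sym n \<longleftrightarrow> distinct w \<and> set w = {1..n}"
  by (auto simp: permutations_of_set_def)

lemma Sym_length: "w \<in> Sym n \<Longrightarrow> length w = n"
  by (metis Sym_iff card_atLeastAtMost diff_Suc_1 distinct_card)

lemma all_perms_iff: "w \<in> all_perms \<longleftrightarrow> w \<noteq> [] \<and> distinct w \<and> set w = {1..length w}"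
proof
  assume "w \<in> all_perms"
  then obtain n where n: "n \<ge> 1" "w \<in> Sym n" by (auto simp: all_perms_def)
  then show "w \<noteq> [] \<and> distinct w \<and> set w = {1..length w}"
    using Sym_length[OF n(2)] n unfolding Sym_iff by force
next
  assume "w \<noteq> [] \<and> distinct w \<and> set w = {1..length w}"
  then show "w \<in> all_perms" unfolding all_perms_def
    unfolding Sym_iff by (intro UN_I[of "length w"]) (auto simp: Suc_le_eq Sym_iff)
qed

lemma all_perms_in_Sym_iff:
  assumes "n \<ge> 1" "w \<in> all_perms"
  shows "w \<in> Sym n \<longleftrightarrow> length w = n"
  using assms(2) Sym_length[of w n] unfolding all_perms_iff Sym_iff by metis

definition offset :: "nat list \<Rightarrow> nat list list \<Rightarrow> nat \<Rightarrow> nat" where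
  "offset p as i = (\<Sum>j | j < length p \<and> p ! j < p ! i. length (as ! j))"

definition blocks :: "nat list \<Rightarrow> nat list list \<Rightarrow> nat list list" where
  "blocks p as = map (\<lambda>i. map ((+) (offset p as i)) (as ! i)) [0..<length p]"

lemma inflate_eq_concat_blocks: "inflate p as = concat (blocks p as)"
  by (simp add: inflate_def blocks_def offset_def)

lemma length_blocks [simp]: "length (blocks p as) = length p"
  by (simp add: blocks_def)

lemma nth_blocks [simp]:
  "i < length p \<Longrightarrow> blocks p as ! i = map ((+) (offset p as i)) (as ! i)"
  by (simp add: blocks_def)

text \<open>The left side is the offset sum with the index \<open>i\<close> adjoined, and all its
  indices count towards the offset of \<open>j\<close>.\<close>

lemma offset_step:
  assumes "i < length p" "j < length p" "p ! i < p ! j"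
  shows "offset p as i + length (as ! i) \<le> offset p as j"
proof -
  have "offset p as i + length (as ! i) =
      (\<Sum>k \<in> insert i {k. k < length p \<and> p ! k < p ! i}. length (as ! k))"
    by (subst sum.insert) (auto simp: offset_def)
  also have "\<dots> \<le> offset p as j"
    unfolding offset_def using assms by (intro sum_mono2) auto
  finally show ?thesis .
qed

lemma sum_list_length_nth:
  "sum_list (map length as) = (\<Sum>k<length as. length (as ! k))"
  by (simp add: sum_list_sum_nth atLeast0LessThan)

lemma offset_total:
  assumes "i < length p" "length as = length p"
  shows "offset p as i + length (as ! i) \<le> sum_list (map length as)"
proof -
  have "offset p as i + length (as ! i) =
      (\<Sum>k \<in> insert i {k. k < length p \<and> p ! k < p ! i}. length (as ! k))"
    by (subst sum.insert) (auto simp: offset_def)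
  also have "\<dots> \<le> (\<Sum>k<length as. length (as ! k))"
    using assms by (intro sum_mono2) auto
  finally show ?thesis by (simp add: sum_list_length_nth)
qed

lemma set_nth_all_perms:
  assumes "set as \<subseteq> all_perms" "i < length as"
  shows "set (as ! i) = {1..length (as ! i)}" "distinct (as ! i)" "as ! i \<noteq> []"
  using assms all_perms_iff by (meson nth_mem subsetD)+

lemma blocks_ordered_like:
  assumes "length as = length p" "set as \<subseteq> all_perms"
  shows "ordered_like p (blocks p as)"
  unfolding ordered_like_def
proof (intro conjI allI impI ballI)
  fix i j x y
  assume ij: "i < length p" "j < length p" "p ! i < p ! j"
    and x: "x \<in> set (blocks p as ! i)" and y: "y \<in> set (blocks p as ! j)"
  have "x \<le> offset p as i + length (as ! i)"
    using x ij set_nth_all_perms(1)[OF assms(2), of i] assms(1) by auto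
  moreover have "offset p as j < y"
    using y ij set_nth_all_perms(1)[OF assms(2), of j] assms(1) by auto
  ultimately show "x < y" using offset_step[OF ij, of as] by linarith
qed simp

lemma length_inflate:
  assumes "length as = length p"
  shows "length (inflate p as) = sum_list (map length as)"
proof -
  have "map length (blocks p as) = map length as"
    using assms by (intro nth_equalityI) auto
  then show ?thesis by (simp add: inflate_eq_concat_blocks length_concat)
qed

lemma distinct_blocks:
  assumes "length as = length p" "set as \<subseteq> all_perms" "w \<in> set (blocks p as)"
  shows "distinct w"
proof -
  obtain i where "i < length p" "w = blocks p as ! i" using assms(3) by (metis in_set_conv_nth length_blocks)
  then show ?thesis using set_nth_all_perms(2)[OF assms(2), of i] assms(1) by (simp add: distinct_map)
qed

lemma blocks_nonempty:
  assumes "length as = length p" "set as \<subseteq> all_perms"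
  shows "[] \<notin> set (blocks p as)"
proof
  assume "[] \<in> set (blocks p as)"
  then obtain i where "i < length p" "[] = blocks p as ! i" by (metis in_set_conv_nth length_blocks)
  then show False using set_nth_all_perms(3)[OF assms(2), of i] assms(1) by simp
qed

lemma inflate_in_all_perms:
  assumes "distinct p" "p \<noteq> []" "length as = length p" "set as \<subseteq> all_perms"
  shows "inflate p as \<in> all_perms"
proof -
  let ?N = "sum_list (map length as)"
  have d: "distinct (inflate p as)"
    unfolding inflate_eq_concat_blocks
    by (intro ordered_like_distinct[OF blocks_ordered_like] distinct_blocks assms) (use assms in auto)
  have sub: "set (inflate p as) \<subseteq> {1..?N}"
  proof
    fix x assume "x \<in> set (inflate p as)"
    then obtain i where i: "i < length p" and x: "x \<in> set (blocks p as ! i)"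
      unfolding inflate_eq_concat_blocks in_set_concat_nth length_blocks by blast
    then show "x \<in> {1..?N}"
      using set_nth_all_perms(1)[OF assms(4), of i] offset_total[OF i assms(3)] assms(3) by auto
  qed
  \<comment> \<open>Distinct entries, as many as there are values available, must use every
    value.\<close>
  have "card (set (inflate p as)) = card {1..?N}"
    using d length_inflate[OF assms(3)] by (simp add: distinct_card)
  then have "set (inflate p as) = {1..?N}" using sub by (intro card_subset_eq) auto
  moreover have "inflate p as \<noteq> []"
    using blocks_nonempty[OF assms(3,4)] assms(2)
    by (cases "blocks p as") (auto simp: inflate_eq_concat_blocks dest: arg_cong[where f=length])
  ultimately show ?thesis using d length_inflate[OF assms(3)] by (simp add: all_perms_iff)
qed

text \<open>The values below a given part are exactly those of the parts with a smaller entry of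
  \<open>p\<close>. So the parts of a permutation are forced to be intervals, and shifting each down
  to start at 1 recovers the arguments of the inflation.\<close>

lemma inflate_of_ordered_like:
  assumes w: "concat ws \<in> all_perms" and ol: "ordered_like p ws" and dp: "distinct p"
    and ne: "[] \<notin> set ws"
  obtains as where "length as = length p" "set as \<subseteq> all_perms" "ws = blocks p as"
    "inflate p as = concat ws"
proof -
  let ?s = "\<lambda>i. offset p ws i"
  have len: "length ws = length p" using ol by (simp add: ordered_like_def)
  have dw: "distinct (concat ws)" and sw: "set (concat ws) = {1..length (concat ws)}"
    using w by (auto simp: all_perms_iff)
  have di: "distinct (ws ! i)" if "i < length p" for i
    using dw that len by (simp add: distinct_concat_iff)
  have seti: "set (ws ! i) = {?s i + 1..?s i + length (ws ! i)}" if i: "i < length p" for i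
  proof -
    have sub: "set (ws ! i) \<subseteq> {?s i + 1..?s i + length (ws ! i)}"
    proof
      fix x assume x: "x \<in> set (ws ! i)"
      have xc: "x \<in> set (concat ws)" using x i len by (metis in_set_concat_nth)
      \<comment> \<open>\<open>?L\<close> collects the values of the lower parts. It has
        \<open>?s i\<close> elements and lies below \<open>x\<close>, which bounds \<open>x\<close>
        from below; together with part \<open>i\<close> it covers everything up to \<open>x\<close>,
        which bounds \<open>x\<close> from above.\<close>
      let ?L = "\<Union>j\<in>{j. j < length p \<and> p ! j < p ! i}. set (ws ! j)"
      have cL: "card ?L = ?s i"
      proof -
        have "card ?L = (\<Sum>j | j < length p \<and> p ! j < p ! i. card (set (ws ! j)))"
          by (intro card_UN_disjoint) (auto dest: ordered_like_disjoint[OF ol dp])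
        also have "\<dots> = ?s i"
          unfolding offset_def using di by (intro sum.cong) (auto simp: distinct_card)
        finally show ?thesis .
      qed
      have Lsub: "?L \<subseteq> {1..<x}"
      proof
        fix y assume "y \<in> ?L"
        then obtain j where j: "j < length p" "p ! j < p ! i" "y \<in> set (ws ! j)" by auto
        have "y \<in> set (concat ws)" using j len by (metis in_set_concat_nth)
        then show "y \<in> {1..<x}"
          using ordered_likeD[OF ol j(1) i j(2) j(3) x] sw by auto
      qed
      have "{1..x} \<subseteq> ?L \<union> set (ws ! i)"
      proof
        fix y assume y: "y \<in> {1..x}"
        then have "y \<in> set (concat ws)" using xc unfolding sw by simp
        then obtain j where j: "j < length p" "y \<in> set (ws ! j)"
          unfolding in_set_concat_nth len by blast
        then show "y \<in> ?L \<union> set (ws ! i)"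
          using ordered_like_less_iff[OF ol dp i j(1) _ x j(2)] y dp i
          by (cases "i = j") (auto simp: nth_eq_iff_index_eq not_less le_less)
      qed
      then have "x \<le> card (?L \<union> set (ws ! i))" using card_mono[of "?L \<union> set (ws ! i)" "{1..x}"] by simp
      also have "\<dots> \<le> card ?L + card (set (ws ! i))" by (rule card_Un_le)
      finally have up: "x \<le> ?s i + length (ws ! i)" using cL di[OF i] by (simp add: distinct_card)
      have "?s i \<le> x - 1" using card_mono[OF _ Lsub] cL by simp
      moreover have "x \<ge> 1" using xc sw by auto
      ultimately show "x \<in> {?s i + 1..?s i + length (ws ! i)}" using up by auto
    qed
    show ?thesis using sub di[OF i] by (intro card_subset_eq) (auto simp: distinct_card)
  qed
  define as where "as = map (\<lambda>i. map (\<lambda>x. x - ?s i) (ws ! i)) [0..<length p]"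
  have la: "length as = length p" by (simp add: as_def)
  have nth: "as ! i = map (\<lambda>x. x - ?s i) (ws ! i)" if "i < length p" for i using that by (simp add: as_def)
  have off: "offset p as i = ?s i" for i
    unfolding offset_def by (intro sum.cong) (auto simp: nth)
  have unsh: "map ((+) (?s i)) (as ! i) = ws ! i" if i: "i < length p" for i
    using seti[OF i] by (auto simp: nth[OF i] intro!: map_idI)
  have "set as \<subseteq> all_perms"
  proof
    fix a assume "a \<in> set as"
    then obtain i where i: "i < length p" "a = as ! i" by (metis in_set_conv_nth la)
    have "set a = (\<lambda>x. x - ?s i) ` {?s i + 1..?s i + length (ws ! i)}"
      using i nth seti by simp
    also have "\<dots> = {1..length (ws ! i)}"
    proof -
      have "x \<in> (\<lambda>x. x - ?s i) ` {?s i + 1..?s i + length (ws ! i)}" if "x \<in> {1..length (ws ! i)}" for x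
        using that by (intro image_eqI[of _ _ "x + ?s i"]) auto
      then show ?thesis by auto
    qed
    finally have sa: "set a = {1..length a}" using i nth by simp
    have "distinct a" using di[OF i(1)] unsh[OF i(1)] i(2) by (metis distinct_map)
    moreover have "a \<noteq> []" using ne i len nth by (metis map_is_Nil_conv nth_mem)
    ultimately show "a \<in> all_perms" using sa by (simp add: all_perms_iff)
  qed
  moreover have "ws = blocks p as"
    using len unsh off by (intro nth_equalityI) auto
  ultimately show ?thesis using that[OF la] by (simp add: inflate_eq_concat_blocks)
qed

section \<open>The substitution closure of the simple permutations\<close>

text \<open>Words over distinct numbers that are not standardised, so that the parts of a word can be taken
  as literal sublists; only their relative order matters.\<close>

inductive dec :: "nat list set \<Rightarrow> nat list \<Rightarrow> bool" for C where
  single: "dec C [x]"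
| step: "p \<in> C \<Longrightarrow> 2 \<le> length p \<Longrightarrow> ordered_like p ws \<Longrightarrow> (\<forall>w\<in>set ws. dec C w) \<Longrightarrow> dec C (concat ws)"

lemma dec_nonempty: "dec C w \<Longrightarrow> w \<noteq> []"
proof (induction rule: dec.induct)
  case (step p ws)
  then have "ws \<noteq> []" by (auto simp: ordered_like_def)
  then show ?case using step by (cases ws) auto
qed simp

text \<open>Monotonicity of \<open>f\<close> is asked only on the entries of \<open>w\<close>, so
  that truncated subtraction is admissible as well as addition.\<close>

lemma dec_map:
  assumes "dec C w" "\<And>x y. x \<in> set w \<Longrightarrow> y \<in> set w \<Longrightarrow> x < y \<Longrightarrow> f x < f y"
  shows "dec C (map f w)"
  using assms
proof (induction rule: dec.induct)
  case (single x)
  show ?case by (simp add: dec.single)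
next
  case (step p ws)
  have "ordered_like p (map (map f) ws)"
    unfolding ordered_like_def
  proof (intro conjI allI impI ballI)
    show "length (map (map f) ws) = length p" using step.hyps(3) by (simp add: ordered_like_def)
    fix i j x y assume ij: "i < length p" "j < length p" "p ! i < p ! j"
      and xy: "x \<in> set (map (map f) ws ! i)" "y \<in> set (map (map f) ws ! j)"
    have len: "length ws = length p" using step.hyps(3) by (simp add: ordered_like_def)
    obtain x' y' where x': "x' \<in> set (ws ! i)" "x = f x'" and y': "y' \<in> set (ws ! j)" "y = f y'"
      using xy ij len by auto
    have "x' < y'" using ordered_likeD[OF step.hyps(3) ij x'(1) y'(1)] .
    moreover have "x' \<in> set (concat ws)" "y' \<in> set (concat ws)"
      using x' y' ij len in_set_concat_nth by metis+
    ultimately show "x < y" using step.prems x' y' by blast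
  qed
  moreover have "\<forall>w\<in>set (map (map f) ws). dec C w"
    using step.IH step.prems by auto
  ultimately have "dec C (concat (map (map f) ws))" using step.hyps by (intro dec.step) auto
  then show ?case by (simp add: map_concat)
qed

section \<open>Associativity of inflation\<close>

lemma exists_chunks:
  "length xs = sum_list ns \<Longrightarrow> \<exists>xss. concat xss = xs \<and> map length xss = ns"
proof (induction ns arbitrary: xs)
  case (Cons n ns)
  have "length (drop n xs) = sum_list ns" using Cons.prems by simp
  then obtain xss where "concat xss = drop n xs \<and> map length xss = ns"
    using Cons.IH by blast
  then show ?case using Cons.prems by (intro exI[of _ "take n xs # xss"]) auto
qed simp

lemma zip_concat:
  "map length xss = map length yss \<Longrightarrow> zip (concat xss) (concat yss) = concat (map2 zip xss yss)"
proof (induction xss arbitrary: yss)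
  case (Cons xs xss)
  then show ?case by (cases yss) auto
qed simp

text \<open>Pairing each entry with its part removes the indices, which are awkward once the pattern
  is itself a concatenation.\<close>

lemma ordered_like_iff_zip:
  "ordered_like p ws \<longleftrightarrow> length ws = length p \<and>
    (\<forall>(a, u) \<in> set (zip p ws). \<forall>(b, v) \<in> set (zip p ws). a < b \<longrightarrow> (\<forall>x\<in>set u. \<forall>y\<in>set v. x < y))"
proof (cases "length ws = length p")
  case True
  have "(\<forall>(a, u) \<in> set (zip p ws). P a u) \<longleftrightarrow> (\<forall>i<length p. P (p ! i) (ws ! i))" for P
    using True by (auto simp: set_zip)
  then show ?thesis using True by (simp add: ordered_like_def)
qed (auto simp: ordered_like_def)

text \<open>Two levels of inflation: the pattern \<open>concat ps\<close> is cut into chunks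
  \<open>ps\<close>, and \<open>wss\<close> groups the parts accordingly. Inflating chunk by chunk
  and then inflating the outer pattern by the results is the associativity law.\<close>

lemma ordered_like_chunks:
  assumes "ordered_like (concat ps) (concat wss)" "map length wss = map length ps"
  shows "i < length ps \<Longrightarrow> ordered_like (ps ! i) (wss ! i)"
    "ordered_like p ps \<Longrightarrow> ordered_like p (map concat wss)"
proof -
  have len: "length wss = length ps" using assms(2) by (metis length_map)
  have leni: "length (wss ! i) = length (ps ! i)" if "i < length ps" for i
    using assms(2) len that by (metis nth_map)
  have pair: "(a, u) \<in> set (zip (concat ps) (concat wss))"
    if "(a, u) \<in> set (zip (ps ! i) (wss ! i))" "i < length ps" for a u i
  proof -
    have "zip (ps ! i) (wss ! i) \<in> set (map2 zip ps wss)"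
      using that(2) len nth_mem[of i "map2 zip ps wss"] by simp
    then show ?thesis using that(1) unfolding zip_concat[OF assms(2)[symmetric]] set_concat by blast
  qed
  have less: "x < y"
    if "(a, u) \<in> set (zip (concat ps) (concat wss))" "(b, v) \<in> set (zip (concat ps) (concat wss))"
      "a < b" "x \<in> set u" "y \<in> set v" for a b u v x y
    using assms(1) that unfolding ordered_like_iff_zip by blast
  show "ordered_like (ps ! i) (wss ! i)" if i: "i < length ps"
    unfolding ordered_like_iff_zip using leni[OF i] less pair i by blast
  show "ordered_like p (map concat wss)" if ol: "ordered_like p ps"
    unfolding ordered_like_def
  proof (intro conjI allI impI ballI)
    have lp: "length ps = length p" using ol by (simp add: ordered_like_def)
    then show "length (map concat wss) = length p" using len by simp
    have get: "\<exists>a u. (a, u) \<in> set (zip (ps ! i) (wss ! i)) \<and> a \<in> set (ps ! i) \<and> x \<in> set u"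
      if i: "i < length p" and x: "x \<in> set (map concat wss ! i)" for i x
    proof -
      have "x \<in> set (concat (wss ! i))" using i x len lp by simp
      then obtain k where k: "k < length (wss ! i)" "x \<in> set (wss ! i ! k)"
        unfolding in_set_concat_nth by blast
      then have "(ps ! i ! k, wss ! i ! k) \<in> set (zip (ps ! i) (wss ! i))"
        using leni i lp by (auto simp: set_zip)
      then show ?thesis using k leni i lp by (metis nth_mem)
    qed
    fix i j x y assume ij: "i < length p" "j < length p" "p ! i < p ! j"
      and x: "x \<in> set (map concat wss ! i)" and y: "y \<in> set (map concat wss ! j)"
    obtain a u where a: "(a, u) \<in> set (zip (ps ! i) (wss ! i))" "a \<in> set (ps ! i)" "x \<in> set u"
      using get[OF ij(1) x] by blast
    obtain b v where b: "(b, v) \<in> set (zip (ps ! j) (wss ! j))" "b \<in> set (ps ! j)" "y \<in> set v"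
      using get[OF ij(2) y] by blast
    show "x < y"
      using less[OF pair[OF a(1)] pair[OF b(1)] ordered_likeD[OF ol ij a(2) b(2)] a(3) b(3)]
        ij lp by simp
  qed
qed

text \<open>By associativity, inflating an inflation of \<open>p\<close> amounts to inflating
  \<open>p\<close> by chunks that are already inflated. Induction on the decomposition of the
  pattern \<open>w\<close> handles the chunks.\<close>

lemma dec_concat:
  assumes "dec C w" "ordered_like w ws" "\<forall>v\<in>set ws. dec C v"
  shows "dec C (concat ws)"
  using assms
proof (induction arbitrary: ws rule: dec.induct)
  case (single x)
  then obtain v where "ws = [v]" by (auto simp: ordered_like_def length_Suc_conv)
  then show ?case using single by simp
next
  case (step p ps)
  have "length ws = sum_list (map length ps)"
    using step.prems(1) by (simp add: ordered_like_def length_concat)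
  then obtain wss where wss: "concat wss = ws" "map length wss = map length ps"
    using exists_chunks by blast
  have len: "length wss = length ps" using wss(2) by (metis length_map)
  have ol: "ordered_like (concat ps) (concat wss)" using step.prems(1) wss by simp
  have "dec C (concat (wss ! i))" if i: "i < length ps" for i
  proof -
    have "\<forall>v\<in>set (wss ! i). dec C v"
      using step.prems(2) wss(1) i len by (metis in_set_concat_nth)
    then show ?thesis
      using step.IH i ordered_like_chunks(1)[OF ol wss(2) i] by (meson nth_mem)
  qed
  then have "\<forall>v\<in>set (map concat wss). dec C v"
    using len by (auto simp: in_set_conv_nth)
  then have "dec C (concat (map concat wss))"
    using dec.step[OF step.hyps(1,2) ordered_like_chunks(2)[OF ol wss(2) step.hyps(3)]] by blast
  moreover have "concat (map concat wss) = concat ws" using wss(1) by (induction wss arbitrary: ws) auto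
  ultimately show ?case by simp
qed

text \<open>An inductive description of \<open>H n\<close> that gives access to an outermost simple
  pattern; \<open>H_eq_decs\<close> identifies the two.\<close>

definition decs :: "nat \<Rightarrow> nat list set" where
  "decs n = {w \<in> all_perms. dec (Simp_le n) w}"

lemma Simp_le_all_perms: "Simp_le n \<subseteq> all_perms"
  by (auto simp: Simp_le_def simple_perm_def)

lemma dec_blocks:
  assumes "length as = length p"
  shows "(\<forall>w\<in>set (blocks p as). dec C w) \<longleftrightarrow> (\<forall>a\<in>set as. dec C a)"
proof -
  have "dec C (map ((+) s) a) \<longleftrightarrow> dec C a" for s a
  proof
    assume "dec C (map ((+) s) a)"
    \<comment> \<open>Truncated subtraction undoes the shift and is strictly increasing on the
      shifted entries, which are all at least \<open>s\<close>.\<close>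
    then have "dec C (map (\<lambda>x. x - s) (map ((+) s) a))" by (rule dec_map) auto
    then show "dec C a" by (simp add: comp_def)
  qed (auto intro: dec_map)
  then show ?thesis using assms by (auto simp: all_set_conv_all_nth)
qed

lemma inflate_in_decs:
  assumes "p \<in> decs n" "length as = length p" "set as \<subseteq> decs n"
  shows "inflate p as \<in> decs n"
proof -
  have as: "set as \<subseteq> all_perms" using assms(3) by (auto simp: decs_def)
  have "\<forall>w\<in>set (blocks p as). dec (Simp_le n) w"
    using assms(3) dec_blocks[OF assms(2)] by (auto simp: decs_def)
  then have "dec (Simp_le n) (inflate p as)"
    unfolding inflate_eq_concat_blocks using assms(1)
    by (intro dec_concat[OF _ blocks_ordered_like] as assms(2)) (auto simp: decs_def)
  moreover have "inflate p as \<in> all_perms"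
    using assms(1) by (intro inflate_in_all_perms as assms(2)) (auto simp: decs_def all_perms_iff)
  ultimately show ?thesis by (simp add: decs_def)
qed

lemma length1_all_perms: "w \<in> all_perms \<Longrightarrow> length w = 1 \<Longrightarrow> w = [1]"
  by (cases w) (auto simp: all_perms_iff)

lemma singleton_in_decs: "[1] \<in> decs n"
  by (simp add: decs_def all_perms_iff dec.single)

lemma Simp_le_subset_decs: "Simp_le n \<subseteq> decs n"
proof
  fix p assume p: "p \<in> Simp_le n"
  then have pa: "p \<in> all_perms" using Simp_le_all_perms by blast
  show "p \<in> decs n"
  proof (cases "length p = 1")
    case True
    then show ?thesis using length1_all_perms[OF pa] singleton_in_decs by simp
  next
    case False
    then have "2 \<le> length p" using pa by (cases p) (auto simp: all_perms_iff Suc_le_eq)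
    \<comment> \<open>A simple permutation is its own inflation by singletons.\<close>
    then have "dec (Simp_le n) (concat (map (\<lambda>x. [x]) p))"
      by (intro dec.step[OF p]) (auto simp: ordered_like_def dec.single)
    then show ?thesis using pa by (simp add: decs_def)
  qed
qed

lemma decs_cases:
  assumes "w \<in> decs n" "w \<noteq> [1]"
  obtains p as where "p \<in> Simp_le n" "2 \<le> length p" "length as = length p" "set as \<subseteq> decs n"
    "w = inflate p as"
proof -
  have wa: "w \<in> all_perms" and "dec (Simp_le n) w" using assms by (auto simp: decs_def)
  from this(2) show ?thesis
  proof cases
    case (single x)
    then show ?thesis using assms length1_all_perms[OF wa] by simp
  next
    case (step p ws)
    have "[] \<notin> set ws" using step(5) dec_nonempty by blast
    then obtain as where as: "length as = length p" "set as \<subseteq> all_perms" "ws = blocks p as"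
      "inflate p as = concat ws"
      using inflate_of_ordered_like[of ws p] wa step Simp_le_all_perms all_perms_iff
      by (metis subsetD)
    have "\<forall>a\<in>set as. dec (Simp_le n) a" using step(5) dec_blocks[OF as(1)] as(3) by blast
    then have "set as \<subseteq> decs n" using as(2) by (auto simp: decs_def)
    then show ?thesis using that step as by metis
  qed
qed

lemma inflate_singleton: "inflate [1] [w] = w"
proof -
  have "{j. j < length [1::nat] \<and> [1::nat] ! j < [1] ! 0} = {}" by (auto simp: nth_Cons')
  then show ?thesis by (simp add: inflate_def map_idI)
qed

lemma length_nth_less_inflate:
  assumes "length as = length p" "set as \<subseteq> all_perms" "2 \<le> length p" "i < length p"
  shows "length (as ! i) < length (inflate p as)"
proof -
  obtain j where j: "j < length p" "j \<noteq> i"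
  proof (cases "i = 0")
    case True
    then show ?thesis using assms(3) that[of 1] by auto
  next
    case False
    then show ?thesis using assms(3) that[of 0] by force
  qed
  have "length (as ! i) + length (as ! j) = (\<Sum>k\<in>{i, j}. length (as ! k))" using j by simp
  also have "\<dots> \<le> (\<Sum>k<length as. length (as ! k))"
    using assms j by (intro sum_mono2) auto
  also have "\<dots> = length (inflate p as)"
    by (simp only: length_inflate[OF assms(1)] sum_list_length_nth)
  finally have "length (as ! i) + length (as ! j) \<le> length (inflate p as)" .
  moreover have "0 < length (as ! j)" using set_nth_all_perms(3)[OF assms(2), of j] assms(1) j(1) by simp
  ultimately show ?thesis by linarith
qed

text \<open>\<open>decs n\<close> is one of the sets being intersected. Conversely a
  substitution-closed \<open>D\<close> containing the simple permutations contains every member of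
  \<open>decs n\<close>, by induction on length, as the parts of a decomposition are shorter than
  the whole.\<close>

lemma H_eq_decs:
  assumes "n \<ge> 1"
  shows "H n = decs n"
proof
  have "subst_closed (decs n)"
    unfolding subst_closed_def
  proof
    show "decs n \<subseteq> all_perms" by (auto simp: decs_def)
    show "decs n = inflations (decs n) (decs n)"
    proof
      show "decs n \<subseteq> inflations (decs n) (decs n)"
      proof
        \<comment> \<open>Every \<open>w\<close> is the inflation of \<open>[1]\<close> by
          \<open>w\<close>.\<close>
        fix w assume "w \<in> decs n"
        then show "w \<in> inflations (decs n) (decs n)" unfolding inflations_def mem_Collect_eq
          by (intro exI[of _ "[1]"] exI[of _ "[w]"]) (simp add: inflate_singleton singleton_in_decs
            del: One_nat_def)
      qed
      show "inflations (decs n) (decs n) \<subseteq> decs n"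
        using inflate_in_decs by (auto simp: inflations_def)
    qed
  qed
  then show "H n \<subseteq> decs n" unfolding H_def subst_closure_def using Simp_le_subset_decs by blast
  show "decs n \<subseteq> H n" unfolding H_def subst_closure_def
  proof (intro subsetI InterI)
    fix w D assume w: "w \<in> decs n" and D: "D \<in> {D. subst_closed D \<and> Simp_le n \<subseteq> D}"
    then have DD: "inflations D D = D" "Simp_le n \<subseteq> D" by (auto simp: subst_closed_def)
    \<comment> \<open>The induction bottoms out at \<open>[1]\<close>, which is simple and of length
      at most \<open>n\<close> because \<open>n\<close> is positive.\<close>
    have "is_block [1] i m \<Longrightarrow> m = 1" for i m by (simp add: is_block_def)
    then have one: "[1] \<in> D" using assms DD(2)
      by (auto simp: Simp_le_def simple_perm_def all_perms_iff)
    show "w \<in> D" using w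
    proof (induction w rule: length_induct)
      case (1 w)
      show ?case
      proof (cases "w = [1]")
        case False
        obtain p as where w: "p \<in> Simp_le n" "2 \<le> length p" "length as = length p" "set as \<subseteq> decs n"
          "w = inflate p as" using decs_cases[OF 1(2) False] .
        have asa: "set as \<subseteq> all_perms" using w(4) by (auto simp: decs_def)
        have "set as \<subseteq> D"
        proof
          fix a assume a: "a \<in> set as"
          then obtain i where "i < length p" "a = as ! i" using w(3) by (metis in_set_conv_nth)
          then have "length a < length w" using length_nth_less_inflate[OF w(3) asa w(2)] w(5) by simp
          then show "a \<in> D" using 1 a w(4) by blast
        qed
        then show ?thesis using w DD unfolding inflations_def by blast
      qed (use one in simp)
    qed
  qed
qed

section \<open>Descents and inverse descents of inflations\<close>

lemma des_short [simp]: "des [] = 0" "des [x] = 0"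
  by (simp_all add: des_def)

lemma des_Cons_Cons [simp]: "des (x # y # w) = of_bool (x > y) + des (y # w)"
proof -
  have "{i. Suc i < length (x # y # w) \<and> (x # y # w) ! i > (x # y # w) ! Suc i} =
      {i. i = 0 \<and> x > y} \<union> Suc ` {i. Suc i < length (y # w) \<and> (y # w) ! i > (y # w) ! Suc i}"
    (is "?A = ?B \<union> Suc ` ?C")
  proof (rule set_eqI)
    fix i show "i \<in> ?A \<longleftrightarrow> i \<in> ?B \<union> Suc ` ?C"
      by (cases i) auto
  qed
  moreover have "card (?B \<union> Suc ` ?C) = card ?B + card (Suc ` ?C)"
  proof (rule card_Un_disjoint)
    have "finite ?C" by (rule finite_subset[of _ "{..length (y # w)}"]) auto
    then show "finite (Suc ` ?C)" by blast
  qed auto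
  moreover have "card ?B = of_bool (x > y)" by (cases "x > y") auto
  ultimately show ?thesis by (simp add: des_def card_image)
qed

lemma des_append:
  "u \<noteq> [] \<Longrightarrow> v \<noteq> [] \<Longrightarrow> des (u @ v) = des u + des v + of_bool (last u > hd v)"
proof (induction u rule: induct_list012)
  case (2 x)
  then show ?case by (cases v) auto
qed auto

text \<open>At the boundary of two consecutive parts the last entry and the next first entry compare
  like the corresponding entries of \<open>p\<close>; all other descents lie inside a part.\<close>

lemma des_concat:
  assumes "ordered_like p ws" "distinct p" "[] \<notin> set ws"
  shows "des (concat ws) = des p + sum_list (map des ws)"
  using assms
proof (induction p arbitrary: ws rule: induct_list012)
  case 1
  then show ?case by (simp add: ordered_like_def)
next
  case (2 x)
  then obtain u where "ws = [u]" by (auto simp: ordered_like_def length_Suc_conv)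
  then show ?case by simp
next
  case (3 a b p)
  obtain u v us where ws: "ws = u # v # us"
    using 3(3) by (auto simp: ordered_like_def length_Suc_conv)
  have ne: "u \<noteq> []" "v \<noteq> []" using 3(5) ws by auto
  have "last u > hd v \<longleftrightarrow> b < a"
    using ordered_like_less_iff[OF 3(3,4), of 1 0 "hd v" "last u"] ne by (simp add: ws)
  moreover have "des (concat (v # us)) = des (b # p) + sum_list (map des (v # us))"
    using 3(2)[of "v # us"] ordered_like_Cons[of a "b # p" u "v # us"] 3(3-5) ws by auto
  moreover have "des (concat ws) = des u + des (concat (v # us)) + of_bool (last u > hd v)"
    using des_append[of u "concat (v # us)"] ne by (simp add: ws)
  ultimately show ?case by (simp add: ws)
qed

lemma des_map_add: "des (map ((+) s) w) = des w"
  by (induction w rule: induct_list012) auto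

lemma des_inflate:
  assumes "length as = length p" "set as \<subseteq> all_perms" "distinct p"
  shows "des (inflate p as) = des p + sum_list (map des as)"
proof -
  have "map des (blocks p as) = map des as"
    using assms(1) by (intro nth_equalityI) (auto simp: des_map_add)
  then show ?thesis
    using des_concat[OF blocks_ordered_like[OF assms(1,2)] assms(3) blocks_nonempty[OF assms(1,2)]]
    by (simp add: inflate_eq_concat_blocks)
qed

section \<open>Inverse descents through the order in which values occur\<close>

fun before :: "'a list \<Rightarrow> 'a \<Rightarrow> 'a \<Rightarrow> bool" where
  "before [] x y = False"
| "before (a # w) x y = (a = x \<and> y \<in> set w \<or> before w x y)"

lemma before_in_set: "before w x y \<Longrightarrow> x \<in> set w \<and> y \<in> set w"
  by (induction w) auto

lemma before_append:
  "before (u @ v) x y \<longleftrightarrow> before u x y \<or> before v x y \<or> x \<in> set u \<and> y \<in> set v"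
  by (induction u) auto

lemma before_nth:
  assumes "distinct w" "i < length w" "j < length w"
  shows "before w (w ! i) (w ! j) \<longleftrightarrow> i < j"
  using assms
proof (induction w arbitrary: i j)
  case (Cons a w)
  then show ?case
    by (cases i; cases j) (auto dest: before_in_set)
qed simp

text \<open>An inverse descent depends on which of two values occurs first. Between different parts
  the part indices decide this, without computing positions in the concatenation from the lengths of
  all earlier parts.\<close>

lemma before_concat:
  assumes "distinct (concat ws)" "i < length ws" "j < length ws" "x \<in> set (ws ! i)" "y \<in> set (ws ! j)"
    "[] \<notin> set ws"
  shows "before (concat ws) x y \<longleftrightarrow> i < j \<or> i = j \<and> before (ws ! i) x y"
  using assms
proof (induction ws arbitrary: i j)
  case (Cons u ws)
  have in_tail: "z \<in> set (concat ws)" if "z \<in> set (ws ! k)" "k < length ws" for z k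
    using that in_set_concat_nth by metis
  have disj: "set u \<inter> set (concat ws) = {}" "distinct (concat ws)" using Cons.prems(1) by auto
  have b: "before (u @ concat ws) x y \<longleftrightarrow>
      before u x y \<or> before (concat ws) x y \<or> x \<in> set u \<and> y \<in> set (concat ws)"
    by (rule before_append)
  show ?case
  proof (cases i)
    case 0
    then have "x \<in> set u" using Cons.prems by simp
    then have "\<not> before (concat ws) x y" using disj(1) before_in_set[of "concat ws" x y] by blast
    moreover have "y \<in> set (concat ws) \<and> y \<notin> set u" if "j = Suc k" for k
      using in_tail[of y k] Cons.prems that disj(1) by auto
    ultimately show ?thesis using b 0 \<open>x \<in> set u\<close> Cons.prems disj(1) before_in_set[of u x y]
      by (cases j) auto
  next
    case (Suc i')
    then have x: "x \<in> set (concat ws)" "x \<notin> set u" using in_tail[of x i'] Cons.prems disj(1) by auto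
    then have nu: "\<not> before u x y" using before_in_set by fastforce
    show ?thesis
    proof (cases j)
      case 0
      then have "y \<notin> set (concat ws)" using Cons.prems disj(1) by auto
      then have "\<not> before (concat ws) x y" using before_in_set[of "concat ws" x y] by blast
      then show ?thesis using b nu x 0 Suc by auto
    next
      case (Suc j')
      then show ?thesis using b nu x \<open>i = Suc i'\<close> Cons.IH[OF disj(2), of i' j'] Cons.prems by auto
    qed
  qed
qed simp

lemma before_map: "inj f \<Longrightarrow> before (map f w) (f x) (f y) \<longleftrightarrow> before w x y"
  by (induction w) (auto simp: inj_eq inj_image_mem_iff)

text \<open>Recorded by the value \<open>v\<close> and defined for arbitrary words, so that it
  applies to the shifted blocks of an inflation, whose values need not start at 1.\<close>

definition inv_descents :: "nat list \<Rightarrow> nat set" where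
  "inv_descents w = {v. v \<in> set w \<and> Suc v \<in> set w \<and> before w (Suc v) v}"

lemma finite_inv_descents [simp]: "finite (inv_descents w)"
  by (rule finite_subset[of _ "set w"]) (auto simp: inv_descents_def)

lemma length_inv_perm [simp]: "length (inv_perm w) = length w"
  by (simp add: inv_perm_def del: upt_Suc)

lemma nth_inv_perm:
  assumes "distinct w" "i < length w" "w ! i = Suc k" "k < length w"
  shows "inv_perm w ! k = Suc i"
proof -
  have "(THE i. i < length w \<and> w ! i = Suc k) = i"
    using assms by (intro the_equality) (simp, metis nth_eq_iff_index_eq)
  then show ?thesis using assms(4) unfolding inv_perm_def by (subst nth_map) (simp_all del: upt_Suc)
qed

lemma ides_eq_card:
  assumes "w \<in> all_perms"
  shows "ides w = card (inv_descents w)"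
proof -
  have d: "distinct w" and s: "set w = {1..length w}" using assms by (auto simp: all_perms_iff)
  have ex: "\<exists>i<length w. w ! i = Suc k" if "k < length w" for k
    using s that by (metis in_set_conv_nth atLeastAtMost_iff Suc_leI le_add1 plus_1_eq_Suc)
  let ?A = "{k. Suc k < length (inv_perm w) \<and> inv_perm w ! k > inv_perm w ! Suc k}"
  \<comment> \<open>Index \<open>k\<close> of the inverse, counted from 0, holds the place of the
    value \<open>Suc k\<close>.\<close>
  have iff: "k \<in> ?A \<longleftrightarrow> Suc k \<in> inv_descents w" for k
  proof (cases "Suc k < length w")
    case True
    obtain i where i: "i < length w" "w ! i = Suc k" using ex[of k] True by auto
    obtain j where j: "j < length w" "w ! j = Suc (Suc k)" using ex[of "Suc k"] True by auto
    have "k \<in> ?A \<longleftrightarrow> j < i"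
      using nth_inv_perm[OF d i] nth_inv_perm[OF d j] True by simp
    also have "\<dots> \<longleftrightarrow> Suc k \<in> inv_descents w"
      using before_nth[OF d j(1) i(1)] i j unfolding inv_descents_def
      by (metis (mono_tags, lifting) mem_Collect_eq nth_mem)
    finally show ?thesis .
  next
    case False
    then show ?thesis unfolding inv_descents_def s by simp
  qed
  have "inv_descents w = Suc ` ?A"
  proof (rule set_eqI)
    fix v show "v \<in> inv_descents w \<longleftrightarrow> v \<in> Suc ` ?A"
    proof (cases v)
      case 0
      then show ?thesis using s by (auto simp: inv_descents_def)
    next
      case (Suc k)
      then show ?thesis using iff[of k] by blast
    qed
  qed
  then show ?thesis by (simp add: ides_def des_def card_image)
qed

lemma inv_descents_map_add: "inv_descents (map ((+) s) w) = (+) s ` inv_descents w"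
proof -
  have "before (map ((+) s) w) (Suc (s + v)) (s + v) \<longleftrightarrow> before w (Suc v) v" for v
    using before_map[of "(+) s" w "Suc v" v] by simp
  then show ?thesis by (auto simp: inv_descents_def)
qed

lemma offset_consecutive:
  assumes "distinct p" "i < length p" "j < length p" "p ! j = Suc (p ! i)"
  shows "offset p as j = offset p as i + length (as ! i)"
proof -
  have "{k. k < length p \<and> p ! k < p ! j} = insert i {k. k < length p \<and> p ! k < p ! i}"
    using assms by (auto simp: less_Suc_eq nth_eq_iff_index_eq)
  then show ?thesis unfolding offset_def by simp
qed

text \<open>An inverse descent of an inflation lies inside one block, or it goes from the largest value of
  one block to the smallest value of the block above it.\<close>

lemma card_inv_descents_inflate:
  assumes len: "length as = length p" and as: "set as \<subseteq> all_perms" and p: "p \<in> all_perms"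
  shows "card (inv_descents (inflate p as)) =
    card (inv_descents p) + (\<Sum>i<length p. card (inv_descents (as ! i)))"
proof -
  define U where "U i = set (blocks p as ! i)" for i
  let ?w = "concat (blocks p as)"
  have dp: "distinct p" and sp: "set p = {1..length p}" using p by (auto simp: all_perms_iff)
  have ol: "ordered_like p (blocks p as)" by (rule blocks_ordered_like[OF len as])
  have dw: "distinct ?w"
    using ordered_like_distinct[OF ol dp] distinct_blocks[OF len as] by blast
  have U: "U i = {offset p as i + 1..offset p as i + length (as ! i)}" if "i < length p" for i
    using set_nth_all_perms(1)[OF as, of i] that len by (simp add: U_def)
  have ne: "0 < length (as ! i)" if "i < length p" for i
    using set_nth_all_perms(3)[OF as, of i] that len by simp
  have bef: "before ?w x y \<longleftrightarrow> i < j \<or> i = j \<and> before (blocks p as ! i) x y"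
    if "i < length p" "j < length p" "x \<in> U i" "y \<in> U j" for i j x y
    using before_concat[OF dw, of i j x y] that blocks_nonempty[OF len as] by (simp add: U_def)
  have inw: "x \<in> set ?w \<longleftrightarrow> (\<exists>i<length p. x \<in> U i)" for x
    unfolding in_set_concat_nth U_def by simp
  \<comment> \<open>\<open>g i\<close> is the largest value of block \<open>i\<close>, and
    \<open>I\<close> holds the positions whose entry of \<open>p\<close> is an inverse
    descent.\<close>
  define g where "g i = offset p as i + length (as ! i)" for i
  define I where "I = {i. i < length p \<and> p ! i \<in> inv_descents p}"
  have gU: "g i \<in> U i" if "i < length p" for i using U[OF that] ne[OF that] by (simp add: g_def Suc_le_eq)
  have disj: "U i \<inter> U j = {}" if "i < length p" "j < length p" "i \<noteq> j" for i j
    using ordered_like_disjoint[OF ol dp that] by (simp add: U_def)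
  have pI: "i \<in> I \<longleftrightarrow> (\<exists>j<i. p ! j = Suc (p ! i))" if i: "i < length p" for i
  proof -
    have "p ! i \<in> inv_descents p \<longleftrightarrow> (\<exists>j<length p. p ! j = Suc (p ! i) \<and> before p (p ! j) (p ! i))"
      unfolding inv_descents_def by (auto simp: in_set_conv_nth i) (metis i)+
    moreover have "before p (p ! j) (p ! i) \<longleftrightarrow> j < i" if "j < length p" for j
      using before_nth[OF dp that i] .
    ultimately show ?thesis using i less_trans[of _ i "length p"] unfolding I_def by blast
  qed
  have eq: "inv_descents ?w = (\<Union>i<length p. inv_descents (blocks p as ! i)) \<union> g ` I"
  proof (intro set_eqI iffI)
    fix v assume "v \<in> inv_descents ?w"
    then obtain i j where i: "i < length p" "v \<in> U i" and j: "j < length p" "Suc v \<in> U j"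
      and b: "before ?w (Suc v) v" unfolding inv_descents_def inw by blast
    have ji: "j < i \<or> j = i \<and> before (blocks p as ! j) (Suc v) v"
      using bef[OF j(1) i(1) j(2) i(2)] b by simp
    show "v \<in> (\<Union>i<length p. inv_descents (blocks p as ! i)) \<union> g ` I"
    proof (cases "i = j")
      case True
      then show ?thesis using i j ji unfolding inv_descents_def U_def by auto
    next
      case False
      then have "p ! i < p ! j"
        using ordered_like_less_iff[OF ol dp i(1) j(1) False, of v "Suc v"] i j by (simp add: U_def)
      \<comment> \<open>A block between the two in value would contain a number strictly between
        \<open>v\<close> and \<open>Suc v\<close>.\<close>
      moreover have "\<not> Suc (p ! i) < p ! j"
      proof
        assume l: "Suc (p ! i) < p ! j"
        moreover have "p ! j \<le> length p" using sp nth_mem[OF j(1)] by auto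
        ultimately have "Suc (p ! i) \<in> set p" unfolding sp by simp
        then obtain l' where l': "l' < length p" "p ! l' = Suc (p ! i)" by (metis in_set_conv_nth)
        have "v < g l'" using ordered_likeD[OF ol i(1) l'(1), of v "g l'"] i gU l' by (simp add: U_def)
        moreover have "g l' < Suc v"
          using ordered_likeD[OF ol l'(1) j(1), of "g l'" "Suc v"] j gU l' l by (simp add: U_def)
        ultimately show False by simp
      qed
      ultimately have pj: "p ! j = Suc (p ! i)" by simp
      have "Suc v \<notin> U i" using disj[OF i(1) j(1) False] j by blast
      then have "v = g i" using i U[OF i(1)] by (simp add: g_def)
      moreover have "i \<in> I" using pI[OF i(1)] ji False pj by auto
      ultimately show ?thesis by blast
    qed
  next
    fix v assume "v \<in> (\<Union>i<length p. inv_descents (blocks p as ! i)) \<union> g ` I"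
    then show "v \<in> inv_descents ?w"
    proof
      assume "v \<in> (\<Union>i<length p. inv_descents (blocks p as ! i))"
      then obtain i where "i < length p" "v \<in> U i" "Suc v \<in> U i" "before (blocks p as ! i) (Suc v) v"
        by (auto simp: inv_descents_def U_def)
      then show ?thesis using bef[of i i "Suc v" v] inw unfolding inv_descents_def by blast
    next
      assume "v \<in> g ` I"
      then obtain i where i: "i \<in> I" "v = g i" by blast
      then have il: "i < length p" by (simp add: I_def)
      obtain j where j: "j < i" "p ! j = Suc (p ! i)" using pI[OF il] i by blast
      have jl: "j < length p" using j il by simp
      have Sv: "Suc v \<in> U j" using offset_consecutive[OF dp il jl j(2), of as] U[OF jl] ne[OF jl] i
        by (simp add: g_def Suc_le_eq)
      have "before ?w (Suc v) v" using bef[OF jl il Sv] gU[OF il] i(2) j(1) by simp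
      moreover have "v \<in> set ?w" "Suc v \<in> set ?w" unfolding inw using il gU i(2) jl Sv by blast+
      ultimately show ?thesis unfolding inv_descents_def by blast
    qed
  qed
  have sub: "inv_descents (blocks p as ! i) \<subseteq> U i" for i by (auto simp: inv_descents_def U_def)
  have "card (inv_descents ?w) = card (\<Union>i<length p. inv_descents (blocks p as ! i)) + card (g ` I)"
    unfolding eq
  proof (rule card_Un_disjoint)
    show "(\<Union>i<length p. inv_descents (blocks p as ! i)) \<inter> g ` I = {}"
    proof (rule ccontr)
      assume "\<not> ?thesis"
      then obtain i k where ik: "i < length p" "k \<in> I" "g k \<in> inv_descents (blocks p as ! i)" by blast
      have kl: "k < length p" using ik(2) by (simp add: I_def)
      have "i = k" using disj[OF ik(1) kl] sub[of i] ik(3) gU[OF kl] by blast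
      moreover have "Suc (g k) \<in> U i" using ik(3) by (auto simp: inv_descents_def U_def)
      ultimately show False using U[OF ik(1)] by (simp add: g_def)
    qed
  qed (auto simp: I_def)
  also have "card (\<Union>i<length p. inv_descents (blocks p as ! i)) =
      (\<Sum>i<length p. card (inv_descents (blocks p as ! i)))"
  proof (intro card_UN_disjoint ballI impI)
    fix i j assume "i \<in> {..<length p}" "j \<in> {..<length p}" "i \<noteq> j"
    then show "inv_descents (blocks p as ! i) \<inter> inv_descents (blocks p as ! j) = {}"
      using disj[of i j] sub[of i] sub[of j] by auto
  qed simp_all
  also have "\<dots> = (\<Sum>i<length p. card (inv_descents (as ! i)))"
    by (intro sum.cong) (auto simp: inv_descents_map_add card_image)
  also have "card (g ` I) = card I"
  proof (rule card_image, rule inj_onI)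
    fix i j assume "i \<in> I" "j \<in> I" "g i = g j"
    then show "i = j" using disj[of i j] gU[of i] gU[of j] by (auto simp: I_def)
  qed
  also have "card I = card (inv_descents p)"
  proof -
    have "(!) p ` I = inv_descents p"
    proof
      show "inv_descents p \<subseteq> (!) p ` I"
      proof
        fix v assume v: "v \<in> inv_descents p"
        then obtain i where "i < length p" "v = p ! i" by (auto simp: inv_descents_def in_set_conv_nth)
        then show "v \<in> (!) p ` I" using v by (auto simp: I_def)
      qed
    qed (auto simp: I_def)
    moreover have "inj_on ((!) p) I" using dp by (auto simp: I_def inj_on_def nth_eq_iff_index_eq)
    ultimately show ?thesis by (metis card_image)
  qed
  finally show ?thesis by (simp add: inflate_eq_concat_blocks)
qed

lemma ides_inflate:
  assumes "length as = length p" "set as \<subseteq> all_perms" "p \<in> all_perms"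
  shows "ides (inflate p as) = ides p + sum_list (map ides as)"
proof -
  have "inflate p as \<in> all_perms"
    using assms by (intro inflate_in_all_perms) (auto simp: all_perms_iff)
  then have "ides (inflate p as) = ides p + (\<Sum>i<length p. card (inv_descents (as ! i)))"
    using card_inv_descents_inflate[OF assms] assms(3) by (simp add: ides_eq_card)
  also have "(\<Sum>i<length p. card (inv_descents (as ! i))) = (\<Sum>i<length p. ides (as ! i))"
    using assms by (intro sum.cong) (auto intro!: ides_eq_card[symmetric])
  also have "\<dots> = sum_list (map ides as)"
    using assms(1) by (simp add: sum_list_sum_nth atLeast0LessThan)
  finally show ?thesis .
qed

section \<open>Uniqueness of the decomposition\<close>

text \<open>Convexity in position and in value are the two hypotheses of
  \<open>convex_subset_part\<close>, which is applied to the parts of a competing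
  decomposition.\<close>

lemma ordered_like_values_convex:
  assumes "ordered_like q vs" "distinct q" "[] \<notin> set vs" "distinct (concat vs)" "j < length q"
  shows "x \<in> set (vs ! j) \<Longrightarrow> z \<in> set (vs ! j) \<Longrightarrow> y \<in> set (concat vs) \<Longrightarrow>
      before (concat vs) x y \<Longrightarrow> before (concat vs) y z \<Longrightarrow> y \<in> set (vs ! j)"
    and "x \<in> set (vs ! j) \<Longrightarrow> z \<in> set (vs ! j) \<Longrightarrow> y \<in> set (concat vs) \<Longrightarrow>
      x < y \<Longrightarrow> y < z \<Longrightarrow> y \<in> set (vs ! j)"
proof -
  have len: "length vs = length q" using assms(1) by (simp add: ordered_like_def)
  show "y \<in> set (vs ! j)"
    if h: "x \<in> set (vs ! j)" "z \<in> set (vs ! j)" "y \<in> set (concat vs)"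
      "before (concat vs) x y" "before (concat vs) y z"
  proof -
    obtain l where l: "l < length vs" "y \<in> set (vs ! l)" using h(3) in_set_concat_nth by metis
    have "j \<le> l" using before_concat[OF assms(4) _ l(1) h(1) l(2) assms(3)] h len assms(5) by auto
    moreover have "l \<le> j" using before_concat[OF assms(4) l(1) _ l(2) h(2) assms(3)] h len assms(5) by auto
    ultimately show ?thesis using l by simp
  qed
  show "y \<in> set (vs ! j)"
    if h: "x \<in> set (vs ! j)" "z \<in> set (vs ! j)" "y \<in> set (concat vs)" "x < y" "y < z"
  proof (rule ccontr)
    assume n: "y \<notin> set (vs ! j)"
    obtain l where l: "l < length q" "y \<in> set (vs ! l)" using h(3) in_set_concat_nth len by metis
    have "l \<noteq> j" using l n by auto
    then show False
      using ordered_like_less_iff[OF assms(1,2) assms(5) l(1) _ h(1) l(2)]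
        ordered_like_less_iff[OF assms(1,2) l(1) assms(5) _ l(2) h(2)] h by auto
  qed
qed

text \<open>Removing an end entry of extreme value would leave a block of length
  \<open>length p - 1\<close>, which is proper as soon as \<open>length p\<close> is at least 3. The
  result serves for the parts at the two ends, which convexity in position cannot reach.\<close>

lemma simple_perm_end:
  assumes p: "simple_perm p" "3 \<le> length p" and i: "i = 0 \<or> Suc i = length p"
  shows "1 < p ! i" "p ! i < length p"
proof -
  have d: "distinct p" and s: "set p = {1..length p}" and ne: "p \<noteq> []"
    using p by (auto simp: simple_perm_def all_perms_iff)
  let ?k = "length p"
  have il: "i < ?k" using i p by auto
  \<comment> \<open>\<open>r\<close> is the start of the word that remains when the end entry is
    removed.\<close>
  obtain r where r: "set (take (?k - 1) (drop r p)) = {1..?k} - {p ! i}" "r \<le> 1"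
  proof (cases "i = 0")
    case True
    obtain a q where pq: "p = a # q" using ne by (cases p) auto
    then have "set q = {1..?k} - {a}" using d s by auto
    then show ?thesis using that[of 1] True pq by simp
  next
    case False
    obtain q a where pq: "p = q @ [a]" using ne by (cases p rule: rev_cases) auto
    then have "i = length q" using i False by simp
    moreover have "set q = {1..?k} - {a}" using d s pq by auto
    ultimately have "set (take (?k - 1) p) = {1..?k} - {p ! i}" using pq by simp
    then show ?thesis using that[of 0] by simp
  qed
  have no: "\<nexists>a b. {1..?k} - {p ! i} = {a..b}"
  proof
    assume "\<exists>a b. {1..?k} - {p ! i} = {a..b}"
    moreover have "1 \<le> ?k - 1" "r + (?k - 1) \<le> length p" using r(2) p(2) by linarith+
    ultimately have "is_block p r (?k - 1)" unfolding is_block_def r(1) by blast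
    then have "?k - 1 = 1 \<or> ?k - 1 = ?k" using p(1) by (auto simp: simple_perm_def)
    then show False using p(2) by auto
  qed
  have "p ! i \<in> {1..?k}" using nth_mem[OF il] unfolding s .
  moreover have "p ! i \<noteq> 1"
  proof
    assume "p ! i = 1"
    then have "{1..?k} - {p ! i} = {2..?k}" by auto
    then show False using no by blast
  qed
  moreover have "p ! i \<noteq> ?k"
  proof
    assume "p ! i = ?k"
    then have "{1..?k} - {p ! i} = {1..?k - 1}" by auto
    then show False using no by blast
  qed
  ultimately show "1 < p ! i" "p ! i < ?k" by auto
qed

text \<open>A set of values that is convex both in position and in value meets a set of parts that forms a
  block of the simple permutation; if it meets all of them, it is everything.\<close>

lemma convex_subset_part:
  assumes p: "simple_perm p" "3 \<le> length p" and ol: "ordered_like p ws" and ne: "[] \<notin> set ws"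
    and dw: "distinct (concat ws)" and I: "I \<subseteq> set (concat ws)" "I \<noteq> set (concat ws)" "I \<noteq> {}"
    and pc: "\<And>x y z. x \<in> I \<Longrightarrow> z \<in> I \<Longrightarrow> y \<in> set (concat ws) \<Longrightarrow>
      before (concat ws) x y \<Longrightarrow> before (concat ws) y z \<Longrightarrow> y \<in> I"
    and vc: "\<And>x y z. x \<in> I \<Longrightarrow> z \<in> I \<Longrightarrow> y \<in> set (concat ws) \<Longrightarrow> x < y \<Longrightarrow> y < z \<Longrightarrow> y \<in> I"
  shows "\<exists>i<length p. I \<subseteq> set (ws ! i)"
proof -
  let ?k = "length p"
  have dp: "distinct p" and sp: "set p = {1..?k}" using p by (auto simp: simple_perm_def all_perms_iff)
  have len: "length ws = ?k" using ol by (simp add: ordered_like_def)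
  \<comment> \<open>The positions of the parts that meet \<open>I\<close>; they are shown to form a
    block of \<open>p\<close>.\<close>
  define J where "J = {i. i < ?k \<and> set (ws ! i) \<inter> I \<noteq> {}}"
  have fJ: "finite J" by (simp add: J_def)
  have inw: "x \<in> set (concat ws)" if "x \<in> set (ws ! i)" "i < ?k" for x i
    using that unfolding in_set_concat_nth len by blast
  have cover: "\<exists>i\<in>J. x \<in> set (ws ! i)" if x: "x \<in> I" for x
  proof -
    have "x \<in> set (concat ws)" using I(1) x by blast
    then obtain i where "i < ?k" "x \<in> set (ws ! i)" unfolding in_set_concat_nth len by blast
    then show ?thesis using x unfolding J_def by blast
  qed
  have nep: "ws ! i \<noteq> []" if "i < ?k" for i using ne that len by (metis nth_mem)
  have bef: "before (concat ws) x y" if "i < j" "j < ?k" "x \<in> set (ws ! i)" "y \<in> set (ws ! j)" for i j x y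
    using before_concat[OF dw _ _ that(3,4) ne] that len by simp
  have inI_pos: "set (ws ! l) \<subseteq> I" if il: "i \<in> J" "j \<in> J" "i < l" "l < j" for i j l
  proof
    fix y assume y: "y \<in> set (ws ! l)"
    obtain x z where x: "x \<in> set (ws ! i)" "x \<in> I" and z: "z \<in> set (ws ! j)" "z \<in> I"
      using il unfolding J_def by blast
    have jk: "j < ?k" using il J_def by auto
    show "y \<in> I" using pc[OF x(2) z(2) inw[OF y] bef[OF il(3) _ x(1) y] bef[OF il(4) jk y z(1)]] il(4) jk by simp
  qed
  have inI_val: "set (ws ! l) \<subseteq> I" if il: "i \<in> J" "j \<in> J" "l < ?k" "p ! i < p ! l" "p ! l < p ! j" for i j l
  proof
    fix y assume y: "y \<in> set (ws ! l)"
    obtain x z where x: "x \<in> set (ws ! i)" "x \<in> I" and z: "z \<in> set (ws ! j)" "z \<in> I"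
      using il unfolding J_def by blast
    have jk: "i < ?k" "j < ?k" using il J_def by auto
    show "y \<in> I" using vc[OF x(2) z(2) inw[OF y il(3)]] ordered_likeD[OF ol jk(1) il(3,4) x(1) y]
        ordered_likeD[OF ol il(3) jk(2) il(5) y z(1)] by simp
  qed
  have inJ: "l \<in> J" if "set (ws ! l) \<subseteq> I" "l < ?k" for l
  proof -
    have "set (ws ! l) \<inter> I = set (ws ! l)" using that(1) by blast
    then show ?thesis using nep[OF that(2)] that(2) by (simp add: J_def)
  qed
  have Jne: "J \<noteq> {}" using cover I(3) by (metis ex_in_conv)
  define a b where "a = Min J" and "b = Max J"
  have ab: "a \<in> J" "b \<in> J" "a \<le> b" using Jne fJ by (auto simp: a_def b_def)
  have bk: "b < ?k" using ab by (auto simp: J_def)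
  have J: "J = {a..b}"
  proof
    show "J \<subseteq> {a..b}" using fJ by (auto simp: a_def b_def)
    show "{a..b} \<subseteq> J"
    proof
      fix l assume l: "l \<in> {a..b}"
      show "l \<in> J"
      proof (cases "l = a \<or> l = b")
        case False
        then have "a < l" "l < b" using l by auto
        then show ?thesis using inJ[OF inI_pos[OF ab(1,2)]] bk by auto
      qed (use ab in auto)
    qed
  qed
  let ?m = "Suc b - a"
  have "is_block p a ?m"
  proof -
    have tk: "set (take ?m (drop a p)) = (!) p ` J"
    proof -
      have "take ?m (drop a p) = map ((!) p) [a..<a + ?m]"
        using ab(3) bk by (intro nth_equalityI) (simp_all del: upt_Suc)
      then have "set (take ?m (drop a p)) = (!) p ` {a..<a + ?m}" by simp
      also have "{a..<a + ?m} = J" using ab(3) J by auto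
      finally show ?thesis .
    qed
    let ?P = "(!) p ` J"
    \<comment> \<open>Values strictly between the extremes belong to parts inside \<open>I\<close>,
      by convexity in value, and hence to \<open>?P\<close>.\<close>
    have "?P = {Min ?P..Max ?P}"
    proof
      show "?P \<subseteq> {Min ?P..Max ?P}" using fJ by auto
      show "{Min ?P..Max ?P} \<subseteq> ?P"
      proof
        fix v assume v: "v \<in> {Min ?P..Max ?P}"
        have fin: "finite ?P" "?P \<noteq> {}" using fJ Jne by auto
        obtain i where i: "i \<in> J" "p ! i = Min ?P" using Min_in[OF fin] by fastforce
        obtain j where j: "j \<in> J" "p ! j = Max ?P" using Max_in[OF fin] by fastforce
        have le: "p ! i \<le> v" "v \<le> p ! j" using v unfolding i(2) j(2) by simp_all
        have "p ! i \<in> set p" "p ! j \<in> set p" using i(1) j(1) by (simp_all add: J_def)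
        then have "v \<in> set p" using le unfolding sp by simp
        then obtain l where l: "l < ?k" "p ! l = v" by (metis in_set_conv_nth)
        show "v \<in> ?P"
        proof (cases "p ! i < v \<and> v < p ! j")
          case True
          then show ?thesis using inJ[OF inI_val[OF i(1) j(1) l(1)] l(1)] l(2) by blast
        next
          case False
          then have "v = p ! i \<or> v = p ! j" using le by linarith
          then show ?thesis using i(1) j(1) by blast
        qed
      qed
    qed
    then show ?thesis unfolding is_block_def tk using ab(3) bk by auto
  qed
  then have "?m = 1 \<or> ?m = ?k" using p(1) unfolding simple_perm_def by blast
  then show ?thesis
  proof
    assume "?m = 1"
    then have "b = a" using ab(3) by linarith
    then have "J = {a}" using J by simp
    then have "I \<subseteq> set (ws ! a)" using cover by blast
    then show ?thesis using ab(3) bk by (intro exI[of _ a]) auto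
  next
    assume "?m = ?k"
    then have Jall: "l \<in> J" if "l < ?k" for l using J bk that by auto
    have "set (ws ! l) \<subseteq> I" if l: "l < ?k" for l
    proof (cases "l = 0 \<or> Suc l = ?k")
      case True
      \<comment> \<open>An end part has parts on one side of it only, but by
        \<open>simple_perm_end\<close> its entry of \<open>p\<close> lies strictly between 1 and
        \<open>?k\<close>, so convexity in value absorbs it.\<close>
      have "1 \<in> set p" "?k \<in> set p" unfolding sp using p(2) by auto
      then obtain i j where "i < ?k" "p ! i = 1" "j < ?k" "p ! j = ?k" by (metis in_set_conv_nth)
      then show ?thesis using inI_val[of i j l] Jall l simple_perm_end[OF p True] by simp
    next
      case False
      then have "0 < l" "l < ?k - 1" using l by linarith+
      moreover have "0 \<in> J" "?k - 1 \<in> J" using l by (intro Jall; linarith)+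
      ultimately show ?thesis by (intro inI_pos)
    qed
    then have "set (concat ws) \<subseteq> I" unfolding subset_iff in_set_concat_nth len by blast
    then show ?thesis using I by blast
  qed
qed

text \<open>Both first parts contain the first letter, so by disjointness each can only be contained
  in the other. They then have equal length and cancel, leaving a smaller instance.\<close>

lemma concat_refine_eq:
  assumes "concat ws = concat vs" "distinct (concat ws)" "[] \<notin> set ws" "[] \<notin> set vs"
    "\<And>u. u \<in> set ws \<Longrightarrow> \<exists>v\<in>set vs. set u \<subseteq> set v" "\<And>v. v \<in> set vs \<Longrightarrow> \<exists>u\<in>set ws. set v \<subseteq> set u"
  shows "ws = vs"
  using assms
proof (induction ws arbitrary: vs)
  case Nil
  then show ?case by (cases vs) auto
next
  case (Cons u ws)
  obtain v vs' where vs: "vs = v # vs'" using Cons.prems by (cases vs) auto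
  have ne: "u \<noteq> []" "v \<noteq> []" using Cons.prems vs by auto
  have hd: "hd u = hd v" using Cons.prems(1) ne vs by (metis concat.simps(2) hd_append2)
  have du: "set u \<inter> \<Union>(set ` set ws) = {}" using Cons.prems(2) by auto
  have "distinct (concat vs)" using Cons.prems(1,2) by simp
  then have dv: "set v \<inter> \<Union>(set ` set vs') = {}" using vs by auto
  have "set u \<subseteq> set v"
  proof -
    obtain v' where "v' \<in> set vs" "set u \<subseteq> set v'" using Cons.prems(5) by auto
    moreover have "hd v \<in> set u" "hd v \<in> set v" using hd ne by (metis hd_in_set)+
    moreover from calculation have "v' \<notin> set vs'" using dv by blast
    ultimately show ?thesis using vs by auto
  qed
  moreover have "set v \<subseteq> set u"
  proof -
    obtain u' where "u' \<in> set (u # ws)" "set v \<subseteq> set u'" using Cons.prems(6) vs by auto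
    moreover have "hd u \<in> set v" "hd u \<in> set u" using hd ne by (metis hd_in_set)+
    moreover from calculation have "u' \<notin> set ws" using du by blast
    ultimately show ?thesis by auto
  qed
  ultimately have suv: "set u = set v" by simp
  moreover have "distinct u" "distinct v" using Cons.prems(2) \<open>distinct (concat vs)\<close> vs by auto
  ultimately have "length u = length v" by (metis distinct_card)
  then have uv: "u = v" "concat ws = concat vs'" using Cons.prems(1) vs by auto
  have "ws = vs'"
  proof (rule Cons.IH[OF uv(2)])
    show "\<exists>v\<in>set vs'. set x \<subseteq> set v" if x: "x \<in> set ws" for x
    proof -
      obtain y where y: "y \<in> set vs" "set x \<subseteq> set y" using Cons.prems(5)[of x] x by auto
      have "set x \<noteq> {}" using x Cons.prems(3) by auto
      moreover have "set x \<inter> set v = {}" using du x suv by auto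
      ultimately have "y \<noteq> v" using y(2) by (metis inf.absorb1)
      then show ?thesis using y vs by auto
    qed
    show "\<exists>v\<in>set ws. set x \<subseteq> set v" if x: "x \<in> set vs'" for x
    proof -
      obtain y where y: "y \<in> set (u # ws)" "set x \<subseteq> set y" using Cons.prems(6)[of x] x vs by auto
      have "set x \<noteq> {}" using x Cons.prems(4) vs by auto
      moreover have "set x \<inter> set u = {}" using dv x suv by auto
      ultimately have "y \<noteq> u" using y(2) by (metis inf.absorb1)
      then show ?thesis using y by auto
    qed
    show "distinct (concat ws)" using Cons.prems(2) by simp
  qed (use Cons.prems(3,4) vs in auto)
  then show ?case using uv vs by simp
qed

lemma nth_all_perms_eq_card:
  assumes "p \<in> all_perms" "i < length p"
  shows "p ! i = Suc (card {j. j < length p \<and> p ! j < p ! i})"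
proof -
  have d: "distinct p" and s: "set p = {1..length p}" using assms by (auto simp: all_perms_iff)
  have "p ! i \<in> {1..length p}" using nth_mem[OF assms(2)] unfolding s .
  have "(!) p ` {j. j < length p \<and> p ! j < p ! i} = {1..<p ! i}"
  proof
    show "(!) p ` {j. j < length p \<and> p ! j < p ! i} \<subseteq> {1..<p ! i}" using s nth_mem[of _ p] by auto
    show "{1..<p ! i} \<subseteq> (!) p ` {j. j < length p \<and> p ! j < p ! i}"
    proof
      fix v assume v: "v \<in> {1..<p ! i}"
      then have "v \<in> set p" unfolding s using \<open>p ! i \<in> _\<close> by auto
      then show "v \<in> (!) p ` {j. j < length p \<and> p ! j < p ! i}" using v by (auto simp: in_set_conv_nth)
    qed
  qed
  moreover have "inj_on ((!) p) {j. j < length p \<and> p ! j < p ! i}"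
    using d by (auto simp: inj_on_def nth_eq_iff_index_eq)
  ultimately have "card {j. j < length p \<and> p ! j < p ! i} = p ! i - 1"
    by (metis card_image card_atLeastLessThan)
  then show ?thesis using \<open>p ! i \<in> _\<close> by simp
qed

text \<open>An entry is one more than the number of smaller entries, so the comparisons determine
  it.\<close>

lemma all_perms_eqI:
  assumes "p \<in> all_perms" "q \<in> all_perms" "length p = length q"
    "\<And>i j. i < length p \<Longrightarrow> j < length p \<Longrightarrow> p ! i < p ! j \<longleftrightarrow> q ! i < q ! j"
  shows "p = q"
proof (rule nth_equalityI[OF assms(3)])
  fix i assume i: "i < length p"
  have "{j. j < length p \<and> p ! j < p ! i} = {j. j < length q \<and> q ! j < q ! i}"
    using assms(3,4) i by auto
  then show "p ! i = q ! i"
    using nth_all_perms_eq_card[OF assms(1) i] nth_all_perms_eq_card[OF assms(2), of i] i assms(3) by simp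
qed

text \<open>The lengths of the blocks determine the offsets, and then the shifts cancel.\<close>

lemma blocks_inject:
  assumes "blocks p as = blocks p bs" "length as = length p" "length bs = length p"
  shows "as = bs"
proof (rule nth_equalityI)
  have l: "length (as ! i) = length (bs ! i)" if "i < length p" for i
    using arg_cong[OF assms(1), of "\<lambda>w. length (w ! i)"] that by simp
  have o: "offset p as i = offset p bs i" for i
    unfolding offset_def using l by (intro sum.cong) auto
  fix i assume "i < length as"
  then have i: "i < length p" using assms by simp
  have "map ((+) (offset p as i)) (as ! i) = map ((+) (offset p as i)) (bs ! i)"
    using arg_cong[OF assms(1), of "\<lambda>w. w ! i"] i o by simp
  then show "as ! i = bs ! i" by (simp add: inj_map_eq_map)
qed (use assms in simp)

lemma nonempty_nth:
  assumes "[] \<notin> set us" "i < length us"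
  obtains x where "x \<in> set (us ! i)"
proof -
  have "us ! i \<noteq> []" using assms nth_mem by fastforce
  then show ?thesis using that hd_in_set by blast
qed

text \<open>Each part of the second decomposition is convex and not the whole word, so it lies in
  one part of the first. Once \<open>q\<close> is known to have length at least 3 the roles can be
  exchanged, and mutual refinement makes the parts equal.\<close>

lemma inflate_simple_unique:
  assumes p: "simple_perm p" "3 \<le> length p" and q: "simple_perm q" "2 \<le> length q"
    and as: "length as = length p" "set as \<subseteq> all_perms"
    and bs: "length bs = length q" "set bs \<subseteq> all_perms"
    and eq: "inflate p as = inflate q bs"
  shows "p = q" "as = bs"
proof -
  let ?ws = "blocks p as" and ?vs = "blocks q bs"
  have pa: "p \<in> all_perms" "distinct p" and qa: "q \<in> all_perms" "distinct q"
    using p q by (auto simp: simple_perm_def all_perms_iff)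
  note olp = blocks_ordered_like[OF as] and olq = blocks_ordered_like[OF bs]
  note nep = blocks_nonempty[OF as] and neq = blocks_nonempty[OF bs]
  have eq': "concat ?ws = concat ?vs" using eq by (simp add: inflate_eq_concat_blocks)
  have dw: "distinct (concat ?ws)"
    using ordered_like_distinct[OF olp pa(2)] distinct_blocks[OF as] by blast
  \<comment> \<open>Stated for arbitrary patterns and words because it is used in both
    directions.\<close>
  have refine: "\<exists>i<length p. set (vs ! j) \<subseteq> set (ws ! i)"
    if r: "simple_perm p" "3 \<le> length p" "distinct q" "2 \<le> length q"
      and olp: "ordered_like p ws" and olq: "ordered_like q vs" and nw: "[] \<notin> set ws" and nv: "[] \<notin> set vs"
      and e: "concat ws = concat vs" and d: "distinct (concat ws)" and j: "j < length q"
    for p q ws vs j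
  proof (rule convex_subset_part[OF r(1,2) olp nw d])
    have lv: "length vs = length q" using olq by (simp add: ordered_like_def)
    show "set (vs ! j) \<subseteq> set (concat ws)" using j lv e in_set_concat_nth by (metis subsetI)
    show "set (vs ! j) \<noteq> {}" using nv j lv by (metis nth_mem set_empty)
    show "set (vs ! j) \<noteq> set (concat ws)"
    proof -
      define l where "l = (if j = 0 then 1 else 0 :: nat)"
      have l: "l < length q" "l \<noteq> j" using r(4) by (auto simp: l_def)
      obtain x where x: "x \<in> set (vs ! l)" using nonempty_nth[OF nv, of l] l lv by metis
      have "x \<notin> set (vs ! j)" using ordered_like_disjoint[OF olq r(3) l(1) j l(2)] x by blast
      moreover have "x \<in> set (concat ws)" using x l lv e in_set_concat_nth by metis
      ultimately show ?thesis by blast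
    qed
    fix x y z assume xz: "x \<in> set (vs ! j)" "z \<in> set (vs ! j)" and y: "y \<in> set (concat ws)"
    have d': "distinct (concat vs)" and y': "y \<in> set (concat vs)" using d y unfolding e .
    show "y \<in> set (vs ! j)" if "before (concat ws) x y" "before (concat ws) y z"
      using ordered_like_values_convex(1)[OF olq r(3) nv d' j xz y'] that unfolding e .
    show "y \<in> set (vs ! j)" if "x < y" "y < z"
      using ordered_like_values_convex(2)[OF olq r(3) nv d' j xz y' that] .
  qed
  have vw: "\<exists>i<length p. set (?vs ! j) \<subseteq> set (?ws ! i)" if "j < length q" for j
    using refine[OF p qa(2) q(2) olp olq nep neq eq' dw that] .
  have q3: "3 \<le> length q"
  proof (rule ccontr)
    assume "\<not> 3 \<le> length q"
    then have q2: "length q = 2" using q(2) by simp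
    \<comment> \<open>\<open>f\<close> sends a part of the second decomposition to the part of the
      first that contains it. It is onto, as the parts of the first are nonempty, so
      \<open>q\<close> cannot be shorter than \<open>p\<close>.\<close>
    define f where "f j = (SOME i. i < length p \<and> set (?vs ! j) \<subseteq> set (?ws ! i))" for j
    have f: "f j < length p \<and> set (?vs ! j) \<subseteq> set (?ws ! f j)" if "j < length q" for j
      unfolding f_def by (rule someI_ex[OF vw[OF that]])
    have "{..<length p} \<subseteq> f ` {..<length q}"
    proof
      fix i assume "i \<in> {..<length p}"
      then have i: "i < length p" by simp
      obtain x where x: "x \<in> set (?ws ! i)" using nonempty_nth[OF nep, of i] i by auto
      then have "x \<in> set (concat ?ws)" using i unfolding in_set_concat_nth length_blocks by blast
      then obtain j where j: "j < length q" "x \<in> set (?vs ! j)"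
        unfolding eq' in_set_concat_nth length_blocks by blast
      then have "x \<in> set (?ws ! f j)" using f[OF j(1)] by blast
      then have "f j = i" using ordered_like_disjoint[OF olp pa(2) i, of "f j"] f[OF j(1)] x by auto
      then show "i \<in> f ` {..<length q}" using j by blast
    qed
    then have "card {..<length p} \<le> card (f ` {..<length q})" by (intro card_mono) auto
    also have "\<dots> \<le> card {..<length q}" by (rule card_image_le) simp
    finally show False using p(2) q2 by simp
  qed
  have wv: "\<exists>i<length q. set (?ws ! j) \<subseteq> set (?vs ! i)" if "j < length p" for j
  proof (rule refine[OF q(1) q3 pa(2) _ olq olp neq nep eq'[symmetric] _ that])
    show "2 \<le> length p" using p(2) by simp
    show "distinct (concat ?vs)" using dw unfolding eq' .
  qed
  have same: "?ws = ?vs"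
  proof (rule concat_refine_eq[OF eq' dw nep neq])
    show "\<exists>v\<in>set ?vs. set u \<subseteq> set v" if "u \<in> set ?ws" for u
    proof -
      obtain j where "j < length p" "u = ?ws ! j" using \<open>u \<in> _\<close> by (auto simp: in_set_conv_nth)
      moreover obtain i where "i < length q" "set (?ws ! j) \<subseteq> set (?vs ! i)" using wv calculation by blast
      moreover have "?vs ! i \<in> set ?vs" using calculation by (intro nth_mem) simp
      ultimately show ?thesis by (metis (no_types))
    qed
    show "\<exists>u\<in>set ?ws. set v \<subseteq> set u" if "v \<in> set ?vs" for v
    proof -
      obtain j where "j < length q" "v = ?vs ! j" using \<open>v \<in> _\<close> by (auto simp: in_set_conv_nth)
      moreover obtain i where "i < length p" "set (?vs ! j) \<subseteq> set (?ws ! i)" using vw calculation by blast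
      moreover have "?ws ! i \<in> set ?ws" using calculation by (intro nth_mem) simp
      ultimately show ?thesis by (metis (no_types))
    qed
  qed
  then have len: "length p = length q" by (metis length_blocks)
  show "p = q"
  proof (rule all_perms_eqI[OF pa(1) qa(1) len])
    fix i j assume ij: "i < length p" "j < length p"
    obtain x where x: "x \<in> set (?ws ! i)" using nonempty_nth[OF nep, of i] ij by auto
    obtain y where y: "y \<in> set (?ws ! j)" using nonempty_nth[OF nep, of j] ij by auto
    show "p ! i < p ! j \<longleftrightarrow> q ! i < q ! j"
    proof (cases "i = j")
      case False
      then show ?thesis
        using ordered_like_less_iff[OF olp pa(2) ij False x y]
          ordered_like_less_iff[OF olq qa(2) _ _ False, of x y] x y same ij len by simp
    qed simp
  qed
  then show "as = bs" using blocks_inject[of p as bs] same as(1) bs(1) by simp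
qed

section \<open>Sums and skew sums\<close>

abbreviation pairs :: "nat list set" where "pairs \<equiv> {[1, 2], [2, 1]}"

lemma atLeastAtMost_1_2: "{1..2::nat} = {1, 2}"
  by auto

lemma all_perms_length2:
  assumes p: "p \<in> all_perms" "length p = 2"
  shows "p \<in> pairs"
proof -
  obtain a b where ab: "p = [a, b]" using p(2) by (auto simp: length_Suc_conv numeral_2_eq_2)
  have "set p = {1, 2}" using p unfolding all_perms_iff p(2) atLeastAtMost_1_2 by blast
  then have "a = 1 \<and> b = 2 \<or> a = 2 \<and> b = 1" unfolding ab by (simp add: doubleton_eq_iff)
  then show ?thesis using ab by blast
qed

lemma pairs_simple:
  assumes e: "e \<in> pairs"
  shows "simple_perm e"
proof -
  have l: "length e = 2" using e by auto
  have "set e = {1, 2}" "distinct e" "e \<noteq> []" using e by auto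
  then have "e \<in> all_perms" unfolding all_perms_iff l atLeastAtMost_1_2 by blast
  moreover have "m = 1 \<or> m = length e" if "is_block e i m" for i m
    using that unfolding is_block_def l by linarith
  ultimately show ?thesis unfolding simple_perm_def by blast
qed

lemma blocks_pair:
  "blocks [1, 2] [a, b] = [a, map ((+) (length a)) b]"
  "blocks [2, 1] [a, b] = [map ((+) (length b)) a, b]"
proof -
  have *: "{j. j < length [1, 2 :: nat] \<and> [1, 2 :: nat] ! j < [1, 2] ! 0} = {}"
    "{j. j < length [1, 2 :: nat] \<and> [1, 2 :: nat] ! j < [1, 2] ! 1} = {0}"
    "{j. j < length [2, 1 :: nat] \<and> [2, 1 :: nat] ! j < [2, 1] ! 0} = {1}"
    "{j. j < length [2, 1 :: nat] \<and> [2, 1 :: nat] ! j < [2, 1] ! 1} = {}"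
    by (auto simp: nth_Cons' less_Suc_eq)
  have o: "offset [1, 2] [a, b] 0 = 0" "offset [1, 2] [a, b] 1 = length a"
    "offset [2, 1] [a, b] 0 = length b" "offset [2, 1] [a, b] 1 = 0"
    unfolding offset_def * by simp_all
  show "blocks [1, 2] [a, b] = [a, map ((+) (length a)) b]"
    using o(1,2) by (simp add: blocks_def map_idI)
  show "blocks [2, 1] [a, b] = [map ((+) (length b)) a, b]"
    using o(3,4) by (simp add: blocks_def map_idI)
qed

lemma inflate_pair:
  "inflate [1, 2] [a, b] = a @ map ((+) (length a)) b"
  "inflate [2, 1] [a, b] = map ((+) (length b)) a @ b"
  unfolding inflate_eq_concat_blocks blocks_pair by simp_all

lemma inflate_pair_assoc:
  "e \<in> pairs \<Longrightarrow> inflate e [inflate e [a, b], c] = inflate e [a, inflate e [b, c]]"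
  by (auto simp del: One_nat_def simp: inflate_pair add.assoc)

lemma length_inflate_pair: "e \<in> pairs \<Longrightarrow> length (inflate e [a, b]) = length a + length b"
  by (auto simp del: One_nat_def simp: inflate_pair)

text \<open>Comparing first entries would give \<open>length d < length a\<close>, comparing last
  entries \<open>length a \<le> length d\<close>.\<close>

lemma inflate_pairs_neq:
  assumes "a \<in> all_perms" "b \<in> all_perms" "c \<in> all_perms" "d \<in> all_perms"
  shows "inflate [1, 2] [a, b] \<noteq> inflate [2, 1] [c, d]"
proof
  assume eq: "inflate [1, 2] [a, b] = inflate [2, 1] [c, d]"
  have ne: "a \<noteq> []" "b \<noteq> []" "c \<noteq> []" "d \<noteq> []" using assms by (auto simp: all_perms_iff)
  have s: "set a = {1..length a}" "set b = {1..length b}" "set c = {1..length c}" "set d = {1..length d}"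
    using assms by (simp_all add: all_perms_iff)
  have "hd a = hd c + length d"
    using arg_cong[OF eq, of hd] ne unfolding inflate_pair by (simp add: hd_map)
  moreover have "last d = last b + length a"
    using arg_cong[OF eq, of last] ne unfolding inflate_pair by (simp add: last_map)
  moreover have "hd a \<le> length a" using hd_in_set[OF ne(1)] unfolding s by simp
  moreover have "last d \<le> length d" using last_in_set[OF ne(4)] unfolding s by simp
  moreover have "1 \<le> hd c" using hd_in_set[OF ne(3)] unfolding s by simp
  ultimately show False by linarith
qed

lemma ordered_like_pair:
  "ordered_like [1, 2] [u, v] \<longleftrightarrow> (\<forall>x\<in>set u. \<forall>y\<in>set v. x < y)"
  "ordered_like [2, 1] [u, v] \<longleftrightarrow> (\<forall>x\<in>set u. \<forall>y\<in>set v. y < x)"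
  unfolding ordered_like_iff_zip by auto

text \<open>Cancelling the common initial segment shows that the longer first component decomposes
  again along \<open>e\<close>. Hence first components that do not split have equal length.\<close>

lemma inflate_pair_longer:
  assumes e: "e \<in> pairs" and p: "a \<in> all_perms" "b \<in> all_perms" "c \<in> all_perms" "d \<in> all_perms"
    and eq: "inflate e [a, b] = inflate e [c, d]" and l: "length a < length c"
  shows "\<exists>f\<in>all_perms. c = inflate e [a, f]"
proof -
  have s: "set a = {1..length a}" "set b = {1..length b}" "set c = {1..length c}" "set d = {1..length d}"
    using p by (simp_all add: all_perms_iff)
  have ane: "a \<noteq> []" using p by (simp add: all_perms_iff)
  consider "e = [1, 2]" | "e = [2, 1]" using e by blast
  then show ?thesis
  proof cases
    case 1
    have eq': "a @ map ((+) (length a)) b = c @ map ((+) (length c)) d"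
      using eq unfolding 1 inflate_pair .
    obtain u where u: "c = a @ u" "map ((+) (length a)) b = u @ map ((+) (length c)) d"
      using eq' l by (auto simp: append_eq_append_conv2)
    have "y > length a" if "y \<in> set u" for y
    proof -
      have "y \<in> set (map ((+) (length a)) b)" using that u(2) by simp
      then show ?thesis using s(2) by auto
    qed
    then have ol: "ordered_like [1, 2] [a, u]" unfolding ordered_like_pair using s(1) by fastforce
    have "concat [a, u] \<in> all_perms" "[] \<notin> set [a, u]" using u p l ane by auto
    then obtain as where as: "length as = length [1, 2 :: nat]" "set as \<subseteq> all_perms" "[a, u] = blocks [1, 2] as"
      "inflate [1, 2] as = concat [a, u]"
      using inflate_of_ordered_like[OF _ ol] by auto
    obtain a' f where "as = [a', f]" using as(1) by (auto simp: length_Suc_conv)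
    moreover from this have "a' = a" using as(3) unfolding calculation blocks_pair by simp
    ultimately have "f \<in> all_perms" "c = inflate e [a, f]" using as(2,4) u(1) 1 by simp_all
    then show ?thesis by blast
  next
    case 2
    let ?n = "length d"
    have eq': "map ((+) (length b)) a @ b = map ((+) ?n) c @ d"
      using eq unfolding 2 inflate_pair .
    have "length b + length a = length c + ?n" using arg_cong[OF eq', of length] by simp
    obtain u where
      "map ((+) (length b)) a = map ((+) ?n) c @ u \<and> u @ b = d \<or>
       map ((+) (length b)) a @ u = map ((+) ?n) c \<and> b = u @ d"
      using eq' unfolding append_eq_append_conv2 by blast
    moreover have "map ((+) (length b)) a \<noteq> map ((+) ?n) c @ u"
      using l by (auto dest: arg_cong[where f = length])
    ultimately have u: "map ((+) ?n) c = map ((+) (length b)) a @ u" "b = u @ d" by metis+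
    \<comment> \<open>In a skew sum the first component stands on top, so \<open>c\<close> is
      recovered by subtracting the length of \<open>d\<close>; \<open>?x\<close> and
      \<open>?y\<close> are the resulting pieces of \<open>c\<close>.\<close>
    let ?x = "map (\<lambda>v. v - ?n) (map ((+) (length b)) a)" and ?y = "map (\<lambda>v. v - ?n) u"
    have "map (\<lambda>v. v - ?n) (map ((+) ?n) c) = ?x @ ?y" unfolding u(1) by simp
    then have c: "c = ?x @ ?y" by (simp add: comp_def)
    have "v - ?n < length b + w - ?n" if "v \<in> set u" "w \<in> set a" for v w
    proof -
      have "v \<in> set (map ((+) ?n) c)" unfolding u(1) using that by simp
      then have "?n < v" using s(3) by auto
      moreover have "v \<in> set b" using u(2) that by simp
      then have "v \<le> length b" using s(2) by simp
      moreover have "w > 0" using that s(1) by auto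
      ultimately show ?thesis by linarith
    qed
    then have ol: "ordered_like [2, 1] [?x, ?y]" unfolding ordered_like_pair by simp
    have "u \<noteq> []" using u l arg_cong[OF u(1), of length] by auto
    then have "concat [?x, ?y] \<in> all_perms" "[] \<notin> set [?x, ?y]" using c p(3) ane by auto
    then obtain as where as: "length as = length [2, 1 :: nat]" "set as \<subseteq> all_perms"
      "[?x, ?y] = blocks [2, 1] as" "inflate [2, 1] as = concat [?x, ?y]"
      using inflate_of_ordered_like[OF _ ol] by auto
    obtain a' f where af: "as = [a', f]" using as(1) by (auto simp: length_Suc_conv)
    have b: "?x = map ((+) (length f)) a'" "?y = f" using as(3) unfolding af blocks_pair by simp_all
    have "?x = map ((+) (length f)) a" using b(2) u(2) by auto
    then have "map ((+) (length f)) a' = map ((+) (length f)) a" using b(1) by metis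
    then have "a' = a" by (simp add: inj_map_eq_map)
    then have "f \<in> all_perms" "c = inflate e [a, f]" using as(2,4) c 2 af by simp_all
    then show ?thesis by blast
  qed
qed

text \<open>Decomposability as a sum for \<open>[1, 2]\<close> and as a skew sum for
  \<open>[2, 1]\<close>. The components range over all permutations, so the notion does not depend
  on the class; \<open>splits_pair_decs\<close> brings them back into \<open>decs n\<close>.\<close>

definition splits :: "nat list \<Rightarrow> nat list \<Rightarrow> bool" where
  "splits e w \<longleftrightarrow> (\<exists>a\<in>all_perms. \<exists>b\<in>all_perms. w = inflate e [a, b])"

text \<open>The decomposition provided by membership in \<open>decs n\<close> must have pattern
  \<open>e\<close>: a longer pattern is excluded by uniqueness, the other pattern of length 2 by
  \<open>inflate_pairs_neq\<close>.\<close>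

lemma splits_pair_decs:
  assumes w: "w \<in> decs n" and e: "e \<in> pairs" and s: "splits e w"
  shows "\<exists>a\<in>decs n. \<exists>b\<in>decs n. w = inflate e [a, b]"
proof -
  obtain a b where ab: "a \<in> all_perms" "b \<in> all_perms" "w = inflate e [a, b]" using s by (auto simp: splits_def)
  have "length a > 0" "length b > 0" using ab by (auto simp: all_perms_iff)
  then have "2 \<le> length w" 
    using length_inflate_pair[OF e, of a b] unfolding ab(3) by linarith
  then have "w \<noteq> [1]" by auto
  then obtain p as where p: "p \<in> Simp_le n" "2 \<le> length p" "length as = length p" "set as \<subseteq> decs n"
    "w = inflate p as" using decs_cases[OF w] by metis
  have asa: "set as \<subseteq> all_perms" using p(4) by (auto simp: decs_def)
  have le: "length e = 2" using e by auto
  have "\<not> 3 \<le> length p"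
  proof
    assume l: "3 \<le> length p"
    have "p = e"
      by (rule inflate_simple_unique(1)[OF _ l pairs_simple[OF e] _ p(3) asa, of "[a, b]"])
        (use p ab le in \<open>auto simp: Simp_le_def\<close>)
    then show False using l le by simp
  qed
  then have l2: "length p = 2" using p(2) by simp
  then have "p \<in> pairs" using all_perms_length2 p(1) Simp_le_all_perms by blast
  obtain c d where cd: "as = [c, d]" using p(3) l2 by (auto simp: length_Suc_conv numeral_2_eq_2)
  have "p = e"
    using inflate_pairs_neq[of a b c d] inflate_pairs_neq[of c d a b] ab asa cd p(5) \<open>p \<in> pairs\<close> e
    by fastforce
  then show ?thesis using p cd by auto
qed

lemma listset_pair: "listset [A, B] = {[a, b] | a b. a \<in> A \<and> b \<in> B}"
  by (auto simp: set_Cons_def)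

lemma splits_decs_eq_image:
  assumes e: "e \<in> pairs" and n: "2 \<le> n"
  shows "{w \<in> decs n. splits e w} = inflate e ` listset [{w \<in> decs n. \<not> splits e w}, decs n]"
proof
  have en: "e \<in> decs n" 
    by (rule subsetD[OF Simp_le_subset_decs]) (use pairs_simple[OF e] e n in \<open>auto simp: Simp_le_def\<close>)
  have da: "a \<in> all_perms" if "a \<in> decs n" for a using that by (simp add: decs_def)
  show "inflate e ` listset [{w \<in> decs n. \<not> splits e w}, decs n] \<subseteq> {w \<in> decs n. splits e w}"
    unfolding listset_pair splits_def using inflate_in_decs[OF en] e da by auto
  show "{w \<in> decs n. splits e w} \<subseteq> inflate e ` listset [{w \<in> decs n. \<not> splits e w}, decs n]"
  proof
    fix w assume w: "w \<in> {w \<in> decs n. splits e w}"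
    \<comment> \<open>The first component is taken as short as possible: if it split, associativity
      would move its second half to the right and leave a shorter one.\<close>
    define P where "P a \<longleftrightarrow> a \<in> decs n \<and> (\<exists>b\<in>decs n. w = inflate e [a, b])" for a
    have "\<exists>a. P a" using splits_pair_decs[of w n e] w e unfolding P_def by blast
    then obtain a where a: "P a" "\<And>c. P c \<Longrightarrow> length a \<le> length c" 
      using ex_has_least_nat[of P _ length] by metis
    obtain b where b: "b \<in> decs n" "w = inflate e [a, b]" using a(1) P_def by blast
    have "\<not> splits e a"
    proof
      assume "splits e a"
      then obtain c d where cd: "c \<in> decs n" "d \<in> decs n" "a = inflate e [c, d]"
        using splits_pair_decs[OF _ e, of a n] a(1) unfolding P_def by blast
      have "w = inflate e [c, inflate e [d, b]]" using b(2) cd(3) inflate_pair_assoc[OF e] by simp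
      moreover have "inflate e [d, b] \<in> decs n" using inflate_in_decs[OF en, of "[d, b]"] cd b e by auto
      ultimately have "P c" unfolding P_def using cd(1) by blast
      then have "length a \<le> length c" by (rule a(2))
      moreover have "0 < length d" using da[OF cd(2)] by (simp add: all_perms_iff)
      ultimately show False using length_inflate_pair[OF e, of c d] cd(3) by simp
    qed
    then show "w \<in> inflate e ` listset [{w \<in> decs n. \<not> splits e w}, decs n]"
      using a(1) b unfolding listset_pair P_def by blast
  qed
qed

lemma inj_on_inflate_pair:
  assumes e: "e \<in> pairs"
  shows "inj_on (inflate e) (listset [{w \<in> decs n. \<not> splits e w}, decs n])"
proof (rule inj_onI)
  fix as cs assume "as \<in> listset [{w \<in> decs n. \<not> splits e w}, decs n]"
    "cs \<in> listset [{w \<in> decs n. \<not> splits e w}, decs n]" and eq: "inflate e as = inflate e cs"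
  then obtain a b c d where ab: "as = [a, b]" "cs = [c, d]" "\<not> splits e a" "\<not> splits e c"
    and p: "a \<in> all_perms" "b \<in> all_perms" "c \<in> all_perms" "d \<in> all_perms"
    unfolding listset_pair decs_def by blast
  have eq': "inflate e [a, b] = inflate e [c, d]" using eq ab by simp
  have "length a = length c"
  proof (rule linorder_cases[of "length a" "length c"])
    assume "length a < length c"
    then show ?thesis using inflate_pair_longer[OF e p eq'] ab(4) p unfolding splits_def by blast
  next
    assume "length c < length a"
    then show ?thesis using inflate_pair_longer[OF e p(3,4,1,2) eq'[symmetric]] ab(3) p unfolding splits_def by blast
  qed
  moreover have "length a + length b = length c + length d"
    using arg_cong[OF eq', of length] length_inflate_pair[OF e] by simp
  ultimately have "length a = length c" "length b = length d" by auto
  then show "as = cs" using eq' e unfolding ab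
    by (auto simp del: One_nat_def simp: inflate_pair inj_map_eq_map)
qed

section \<open>Generating functions\<close>

text \<open>Size and weight are parameters because the function is also applied to pairs and to
  lists of permutations.\<close>

definition gf :: "('a \<Rightarrow> nat) \<Rightarrow> ('a \<Rightarrow> 'r::comm_ring_1) \<Rightarrow> 'a set \<Rightarrow> 'r fps" where
  "gf sz wt X = Abs_fps (\<lambda>n. \<Sum>x | x \<in> X \<and> sz x = n. wt x)"

text \<open>A sum over an infinite set is 0 by convention, so the union and product laws ask each
  level to be finite.\<close>

definition finite_levels :: "('a \<Rightarrow> nat) \<Rightarrow> 'a set \<Rightarrow> bool" where
  "finite_levels sz X \<longleftrightarrow> (\<forall>n. finite {x. x \<in> X \<and> sz x = n})"

lemma gf_nth: "fps_nth (gf sz wt X) n = (\<Sum>x | x \<in> X \<and> sz x = n. wt x)"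
  by (simp add: gf_def)

lemma finite_levels_subset: "finite_levels sz Y \<Longrightarrow> X \<subseteq> Y \<Longrightarrow> finite_levels sz X"
  unfolding finite_levels_def by (auto intro: rev_finite_subset)

lemma finite_levels_image:
  assumes "finite_levels sz X" "\<And>x. x \<in> X \<Longrightarrow> sz' (f x) = sz x"
  shows "finite_levels sz' (f ` X)"
  unfolding finite_levels_def
proof
  fix n
  have "{y. y \<in> f ` X \<and> sz' y = n} = f ` {x. x \<in> X \<and> sz x = n}" using assms(2) by auto
  then show "finite {y. y \<in> f ` X \<and> sz' y = n}" using assms(1) by (simp add: finite_levels_def)
qed

lemma gf_Un:
  assumes "finite_levels sz X" "finite_levels sz Y" "X \<inter> Y = {}"
  shows "gf sz wt (X \<union> Y) = gf sz wt X + gf sz wt Y"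
proof (rule fps_ext)
  fix n
  have "{x. x \<in> X \<union> Y \<and> sz x = n} = {x. x \<in> X \<and> sz x = n} \<union> {x. x \<in> Y \<and> sz x = n}" by auto
  then show "fps_nth (gf sz wt (X \<union> Y)) n = fps_nth (gf sz wt X + gf sz wt Y) n"
    using assms unfolding gf_nth fps_add_nth finite_levels_def
    by (simp add: sum.union_disjoint disjoint_iff)
qed

lemma gf_UN:
  assumes "finite I" "\<And>i. i \<in> I \<Longrightarrow> finite_levels sz (X i)"
    "\<And>i j. i \<in> I \<Longrightarrow> j \<in> I \<Longrightarrow> i \<noteq> j \<Longrightarrow> X i \<inter> X j = {}"
  shows "gf sz wt (\<Union>i\<in>I. X i) = (\<Sum>i\<in>I. gf sz wt (X i))"
proof (rule fps_ext)
  fix n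
  have "(\<Sum>x | x \<in> (\<Union>i\<in>I. X i) \<and> sz x = n. wt x) = (\<Sum>x \<in> (\<Union>i\<in>I. {x. x \<in> X i \<and> sz x = n}). wt x)"
    by (intro sum.cong) auto
  also have "\<dots> = (\<Sum>i\<in>I. \<Sum>x | x \<in> X i \<and> sz x = n. wt x)"
  proof (rule sum.UNION_disjoint[OF assms(1)])
    show "\<forall>i\<in>I. finite {x. x \<in> X i \<and> sz x = n}" using assms(2) by (simp add: finite_levels_def)
    show "\<forall>i\<in>I. \<forall>j\<in>I. i \<noteq> j \<longrightarrow> {x. x \<in> X i \<and> sz x = n} \<inter> {x. x \<in> X j \<and> sz x = n} = {}"
      using assms(3) by blast
  qed
  finally show "fps_nth (gf sz wt (\<Union>i\<in>I. X i)) n = fps_nth (\<Sum>i\<in>I. gf sz wt (X i)) n"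
    by (simp add: gf_nth fps_sum_nth)
qed

lemma gf_image:
  assumes "inj_on f X" "\<And>x. x \<in> X \<Longrightarrow> sz' (f x) = sz x" "\<And>x. x \<in> X \<Longrightarrow> wt' (f x) = c * wt x"
  shows "gf sz' wt' (f ` X) = fps_const c * gf sz wt X"
proof (rule fps_ext)
  fix n
  have "{y. y \<in> f ` X \<and> sz' y = n} = f ` {x. x \<in> X \<and> sz x = n}" using assms(2) by auto
  moreover have "inj_on f {x. x \<in> X \<and> sz x = n}" using assms(1) by (rule inj_on_subset) auto
  ultimately show "fps_nth (gf sz' wt' (f ` X)) n = fps_nth (fps_const c * gf sz wt X) n"
    using assms(3) by (simp add: gf_nth sum.reindex sum_distrib_left)
qed

lemma gf_Times:
  assumes "finite_levels sz X" "finite_levels sz' Y"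
  shows "finite_levels (\<lambda>(x, y). sz x + sz' y) (X \<times> Y)"
    "gf (\<lambda>(x, y). sz x + sz' y) (\<lambda>(x, y). wt x * wt' y) (X \<times> Y) = gf sz wt X * gf sz' wt' Y"
proof -
  let ?X = "\<lambda>i. {x. x \<in> X \<and> sz x = i}" and ?Y = "\<lambda>i. {y. y \<in> Y \<and> sz' y = i}"
  have eq: "{z. z \<in> X \<times> Y \<and> (case z of (x, y) \<Rightarrow> sz x + sz' y) = n} = (\<Union>i\<in>{0..n}. ?X i \<times> ?Y (n - i))" for n
    by auto
  have fin: "finite (?X i \<times> ?Y j)" for i j using assms by (simp add: finite_levels_def)
  show "finite_levels (\<lambda>(x, y). sz x + sz' y) (X \<times> Y)"
    unfolding finite_levels_def eq using fin by blast
  show "gf (\<lambda>(x, y). sz x + sz' y) (\<lambda>(x, y). wt x * wt' y) (X \<times> Y) = gf sz wt X * gf sz' wt' Y"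
  proof (rule fps_ext)
    fix n
    have "(\<Sum>z \<in> (\<Union>i\<in>{0..n}. ?X i \<times> ?Y (n - i)). case z of (x, y) \<Rightarrow> wt x * wt' y) =
        (\<Sum>i\<in>{0..n}. \<Sum>z \<in> ?X i \<times> ?Y (n - i). case z of (x, y) \<Rightarrow> wt x * wt' y)"
      using fin by (intro sum.UNION_disjoint) auto
    also have "\<dots> = (\<Sum>i\<in>{0..n}. (\<Sum>x\<in>?X i. wt x) * (\<Sum>y\<in>?Y (n - i). wt' y))"
      unfolding sum_product sum.cartesian_product ..
    finally show "fps_nth (gf (\<lambda>(x, y). sz x + sz' y) (\<lambda>(x, y). wt x * wt' y) (X \<times> Y)) n =
        fps_nth (gf sz wt X * gf sz' wt' Y) n"
      unfolding gf_nth fps_mult_nth eq .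
  qed
qed

lemma gf_listset:
  assumes "\<And>A. A \<in> set As \<Longrightarrow> finite_levels sz A"
  shows "finite_levels (\<lambda>as. sum_list (map sz as)) (listset As)"
    "gf (\<lambda>as. sum_list (map sz as)) (\<lambda>as. prod_list (map wt as)) (listset As) =
      prod_list (map (gf sz wt) As)"
proof -
  have "finite_levels (\<lambda>as. sum_list (map sz as)) (listset As) \<and>
    gf (\<lambda>as. sum_list (map sz as)) (\<lambda>as. prod_list (map wt as)) (listset As) =
      prod_list (map (gf sz wt) As)"
    using assms
  proof (induction As)
    case Nil
    have "gf (\<lambda>as. sum_list (map sz as)) (\<lambda>as. prod_list (map wt as)) {[]} = 1"
      by (rule fps_ext) (auto simp: gf_nth intro!: sum.neutral cong: conj_cong)
    then show ?case by (auto simp: finite_levels_def)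
  next
    case (Cons A As)
    let ?sz = "\<lambda>as. sum_list (map sz as)" and ?wt = "\<lambda>as. prod_list (map wt as)"
    have IH: "finite_levels ?sz (listset As)" "gf ?sz ?wt (listset As) = prod_list (map (gf sz wt) As)"
      using Cons by auto
    have A: "finite_levels sz A" using Cons.prems by simp
    have im: "listset (A # As) = (\<lambda>(a, as). a # as) ` (A \<times> listset As)"
      by (auto simp: set_Cons_def)
    have inj: "inj_on (\<lambda>(a, as). a # as) (A \<times> listset As)" by (auto simp: inj_on_def)
    have "gf ?sz ?wt (listset (A # As)) =
        fps_const 1 * gf (\<lambda>(x, y). sz x + ?sz y) (\<lambda>(x, y). wt x * ?wt y) (A \<times> listset As)"
      unfolding im by (rule gf_image[OF inj]) auto
    then show ?case
      using gf_Times(1)[OF A IH(1)] gf_Times(2)[OF A IH(1), of wt ?wt] IH(2)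
        finite_levels_image[OF gf_Times(1)[OF A IH(1)], of ?sz "\<lambda>(a, as). a # as"]
      unfolding im by auto
  qed
  then show "finite_levels (\<lambda>as. sum_list (map sz as)) (listset As)"
    "gf (\<lambda>as. sum_list (map sz as)) (\<lambda>as. prod_list (map wt as)) (listset As) =
      prod_list (map (gf sz wt) As)" by blast+
qed

section \<open>The cone of gamma-positive polynomials\<close>

text \<open>Generated inductively rather than given by coefficient families, so that closure under
  products is proved on generators; coefficients are read off once, in
  \<open>gamma_cone_coeffs\<close>.\<close>

inductive gamma_cone :: "nat \<Rightarrow> real poly poly \<Rightarrow> bool" where
  zero: "gamma_cone d 0"
| basis: "0 \<le> c \<Longrightarrow> 2 * i + j \<le> d \<Longrightarrow> gamma_cone d ([:[:c:]:] * gamma_basis d i j)"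
| add: "gamma_cone d f \<Longrightarrow> gamma_cone d g \<Longrightarrow> gamma_cone d (f + g)"

text \<open>Under these bounds the truncated differences in the exponents are true ones, so all
  exponents add.\<close>

lemma gamma_basis_mult:
  assumes "2 * i + j \<le> d" "2 * k + l \<le> e"
  shows "gamma_basis d i j * gamma_basis e k l = gamma_basis (d + e) (i + k) (j + l)"
proof -
  obtain m n where "d = 2 * i + j + m" "e = 2 * k + l + n" using assms le_Suc_ex by metis
  then have "d + e - (j + l) - 2 * (i + k) = (d - j - 2 * i) + (e - l - 2 * k)" by simp
  then show ?thesis unfolding gamma_basis_def by (simp only: power_add) (simp only: mult_ac)
qed

text \<open>Distributivity reduces this to two basis elements, where dargas add and nonnegative
  coefficients multiply.\<close>

lemma gamma_cone_mult:
  assumes "gamma_cone d f" "gamma_cone e g"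
  shows "gamma_cone (d + e) (f * g)"
  using assms(1)
proof (induction rule: gamma_cone.induct)
  case (basis c i j d)
  show ?case using assms(2)
  proof (induction rule: gamma_cone.induct)
    case (basis b k l e)
    have "[:[:c:]:] * gamma_basis d i j * ([:[:b:]:] * gamma_basis e k l) =
        ([:[:c:]:] * [:[:b:]:]) * (gamma_basis d i j * gamma_basis e k l)" by (simp only: mult_ac)
    also have "\<dots> = [:[:c * b:]:] * gamma_basis (d + e) (i + k) (j + l)"
      using \<open>2 * i + j \<le> d\<close> basis(2) by (simp add: gamma_basis_mult)
    finally show ?case using \<open>0 \<le> c\<close> \<open>2 * i + j \<le> d\<close> basis
      by (simp only:) (intro gamma_cone.basis; simp)
  qed (auto intro: gamma_cone.intros simp: distrib_left simp del: mult_pCons_left mult_pCons_right)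
qed (auto intro: gamma_cone.intros simp: distrib_right)

lemma gamma_cone_sum: "(\<And>i. i \<in> I \<Longrightarrow> gamma_cone d (f i)) \<Longrightarrow> gamma_cone d (\<Sum>i\<in>I. f i)"
  by (induction I rule: infinite_finite_induct) (auto intro: gamma_cone.intros)

lemma gamma_cone_coeffs:
  assumes "gamma_cone d f"
  shows "\<exists>\<gamma> :: nat \<Rightarrow> nat \<Rightarrow> real. (\<forall>i j. 2 * i + j \<le> d \<longrightarrow> \<gamma> i j \<ge> 0) \<and>
    f = (\<Sum>(i, j) | 2 * i + j \<le> d. [:[:\<gamma> i j:]:] * gamma_basis d i j)"
  using assms
proof (induction rule: gamma_cone.induct)
  case (zero d)
  show ?case by (rule exI[of _ "\<lambda>_ _. 0"]) simp
next
  case (basis c i j d)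
  let ?\<gamma> = "\<lambda>k l. if k = i \<and> l = j then c else 0"
  have fin: "finite {(i, j). 2 * i + j \<le> d}"
    by (rule finite_subset[of _ "{..d} \<times> {..d}"]) auto
  have "(\<Sum>(k, l) | 2 * k + l \<le> d. [:[:?\<gamma> k l:]:] * gamma_basis d k l) =
      (\<Sum>(k, l) \<in> {(i, j)}. [:[:?\<gamma> k l:]:] * gamma_basis d k l)"
    by (rule sum.mono_neutral_right[OF fin]) (use basis(2) in \<open>auto simp del: mult_pCons_left split: if_splits\<close>)
  also have "\<dots> = [:[:c:]:] * gamma_basis d i j" by (simp del: mult_pCons_left)
  finally show ?case using basis(1) by (intro exI[of _ ?\<gamma>]) simp
next
  case (add d f g)
  obtain \<gamma> where \<gamma>: "\<forall>i j. 2 * i + j \<le> d \<longrightarrow> \<gamma> i j \<ge> (0 :: real)"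
    "f = (\<Sum>(i, j) | 2 * i + j \<le> d. [:[:\<gamma> i j:]:] * gamma_basis d i j)" using add.IH(1) by blast
  obtain \<delta> where \<delta>: "\<forall>i j. 2 * i + j \<le> d \<longrightarrow> \<delta> i j \<ge> (0 :: real)"
    "g = (\<Sum>(i, j) | 2 * i + j \<le> d. [:[:\<delta> i j:]:] * gamma_basis d i j)" using add.IH(2) by blast
  have c: "[:[:x + y:]:] * h = [:[:x:]:] * h + [:[:y:]:] * h" for x y :: real and h
  proof -
    have "[:[:x + y:]:] = [:[:x:]:] + [:[:y:]:]" by simp
    then show ?thesis by (simp only: distrib_right)
  qed
  have "f + g = (\<Sum>(i, j) | 2 * i + j \<le> d. [:[:\<gamma> i j + \<delta> i j:]:] * gamma_basis d i j)"
    unfolding \<gamma>(2) \<delta>(2) sum.distrib[symmetric] c by (intro sum.cong) auto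
  then show ?case using \<gamma>(1) \<delta>(1) by (intro exI[of _ "\<lambda>i j. \<gamma> i j + \<delta> i j"]) simp
qed

lemma eval2_simps:
  "eval2 (f + g) s t = eval2 f s t + eval2 g s t" "eval2 (f * g) s t = eval2 f s t * eval2 g s t"
  "eval2 (f ^ k) s t = eval2 f s t ^ k" "eval2 0 s t = 0" "eval2 1 s t = 1"
  "eval2 S_var s t = s" "eval2 T_var s t = t" "eval2 [:[:c:]:] s t = c"
  by (simp_all add: eval2_def S_var_def T_var_def poly_power)

lemma palindromic_gamma_cone:
  assumes "gamma_cone d f"
  shows "palindromic d f"
  using assms
proof (induction rule: gamma_cone.induct)
  case (basis c i j d)
  obtain m where m: "d = 2 * i + j + m" using basis(2) le_Suc_ex by metis
  have ev: "eval2 ([:[:c:]:] * gamma_basis d i j) s t = c * ((s * t) ^ i * (s + t) ^ j * (1 + s * t) ^ m)" for s t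
    unfolding gamma_basis_def eval2_simps m by simp
  have pal: "(s * t) ^ d * (c * ((1 / s * (1 / t)) ^ i * (1 / s + 1 / t) ^ j * (1 + 1 / s * (1 / t)) ^ m)) =
      c * ((s * t) ^ i * (s + t) ^ j * (1 + s * t) ^ m)" if "s \<noteq> 0" "t \<noteq> 0" for s t :: real
  proof -
    \<comment> \<open>The power of \<open>s * t\<close> is shared out by darga: two factors for each
      \<open>s * t\<close>, one for each \<open>s + t\<close> and each
      \<open>1 + s * t\<close>.\<close>
    have "(s * t) ^ d = (s * t * (s * t)) ^ i * (s * t) ^ j * (s * t) ^ m"
      unfolding m power_add mult_2 power_mult_distrib ..
    then have "(s * t) ^ d * (c * ((1 / s * (1 / t)) ^ i * (1 / s + 1 / t) ^ j * (1 + 1 / s * (1 / t)) ^ m)) =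
        c * ((s * t * (s * t) * (1 / s * (1 / t))) ^ i * (s * t * (1 / s + 1 / t)) ^ j *
          (s * t * (1 + 1 / s * (1 / t))) ^ m)"
      by (simp only: power_mult_distrib mult_ac)
    moreover have "s * t * (1 / s + 1 / t) = s + t" "s * t * (s * t) * (1 / s * (1 / t)) = s * t"
      "s * t * (1 + 1 / s * (1 / t)) = 1 + s * t" using that by (simp_all add: distrib_left)
    ultimately show ?thesis by simp
  qed
  show ?case unfolding palindromic_def ev
  proof (rule conjI; intro allI impI)
    fix s t :: real assume "s \<noteq> 0" "t \<noteq> 0"
    from pal[OF this, symmetric]
    show "c * ((s * t) ^ i * (s + t) ^ j * (1 + s * t) ^ m) =
      (s * t) ^ d * (c * ((1 / s * (1 / t)) ^ i * (1 / s + 1 / t) ^ j * (1 + 1 / s * (1 / t)) ^ m))" .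
  next
    fix s t :: real
    show "c * ((s * t) ^ i * (s + t) ^ j * (1 + s * t) ^ m) = c * ((t * s) ^ i * (t + s) ^ j * (1 + t * s) ^ m)"
      by (simp only: mult.commute[of t s] add.commute[of t s])
  qed
next
  case (add d f g)
  then show ?case unfolding palindromic_def eval2_simps distrib_left by metis
qed (simp add: palindromic_def eval2_simps)

lemma gamma_positive_gamma_cone: "gamma_cone d f \<Longrightarrow> gamma_positive d f"
  unfolding gamma_positive_def using palindromic_gamma_cone gamma_cone_coeffs by blast

text \<open>Apart from \<open>a\<close> vanishing leading coefficients, the coefficient of \<open>x ^ m\<close> in \<open>f\<close>
  is a nonnegative combination of basis elements of darga \<open>m - a\<close>, for all \<open>m\<close> up to \<open>N\<close>.\<close>

definition gamma_upto :: "nat \<Rightarrow> nat \<Rightarrow> real poly poly fps \<Rightarrow> bool" where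
  "gamma_upto a N f \<longleftrightarrow>
    (\<forall>m<a. fps_nth f m = 0) \<and> (\<forall>m. a \<le> m \<longrightarrow> m \<le> N \<longrightarrow> gamma_cone (m - a) (fps_nth f m))"

lemma gamma_upto_add: "gamma_upto a N f \<Longrightarrow> gamma_upto a N g \<Longrightarrow> gamma_upto a N (f + g)"
  by (auto simp: gamma_upto_def intro: gamma_cone.add)

lemma gamma_upto_mono: "gamma_upto a N f \<Longrightarrow> M \<le> N \<Longrightarrow> gamma_upto a M f"
  by (auto simp: gamma_upto_def)

text \<open>A factor of darga \<open>k\<close> raises the darga of every coefficient, so the offset
  drops by \<open>k\<close>. The coefficients with index from \<open>a - k\<close> to below
  \<open>a\<close> vanish and so lie in every cone.\<close>

lemma gamma_upto_const_mult:
  assumes "gamma_upto a N f" "gamma_cone k c" "k \<le> a"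
  shows "gamma_upto (a - k) N (fps_const c * f)"
  unfolding gamma_upto_def
proof (intro conjI allI impI)
  fix m assume m: "a - k \<le> m" "m \<le> N"
  show "gamma_cone (m - (a - k)) (fps_nth (fps_const c * f) m)"
  proof (cases "m < a")
    case True
    then show ?thesis using assms(1) by (auto simp: gamma_upto_def intro: gamma_cone.zero)
  next
    case False
    then have "m - (a - k) = k + (m - a)" using assms(3) by linarith
    then show ?thesis using gamma_cone_mult[OF assms(2), of "m - a" "fps_nth f m"] assms(1) m False
      by (simp add: gamma_upto_def)
  qed
qed (use assms(1) in \<open>simp add: gamma_upto_def\<close>)

text \<open>As \<open>f\<close> vanishes below \<open>a\<close> and \<open>g\<close> below
  \<open>b\<close>, the coefficient of \<open>x ^ m\<close> in the product involves \<open>f\<close>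
  only up to \<open>m - b\<close> and \<open>g\<close> only up to \<open>m - a\<close>. This gain in
  range drives the induction.\<close>

lemma gamma_upto_mult:
  assumes "gamma_upto a N f" "gamma_upto b M g" "L \<le> N + b" "L \<le> M + a"
  shows "gamma_upto (a + b) L (f * g)"
  unfolding gamma_upto_def fps_mult_nth
proof (intro conjI allI impI)
  fix m assume "m < a + b"
  then have "i < a \<or> m - i < b" if "i \<in> {0..m}" for i using that by auto
  then have "fps_nth f i = 0 \<or> fps_nth g (m - i) = 0" if "i \<in> {0..m}" for i
    using assms(1,2) that unfolding gamma_upto_def by blast
  then have "fps_nth f i * fps_nth g (m - i) = 0" if "i \<in> {0..m}" for i
    using that by force
  then show "(\<Sum>i=0..m. fps_nth f i * fps_nth g (m - i)) = 0" by (rule sum.neutral[OF ballI])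
next
  fix m assume m: "a + b \<le> m" "m \<le> L"
  show "gamma_cone (m - (a + b)) (\<Sum>i=0..m. fps_nth f i * fps_nth g (m - i))"
  proof (rule gamma_cone_sum)
    fix i assume i: "i \<in> {0..m}"
    show "gamma_cone (m - (a + b)) (fps_nth f i * fps_nth g (m - i))"
    proof (cases "i < a \<or> m - i < b")
      case True
      then show ?thesis using assms(1,2) by (auto simp: gamma_upto_def intro: gamma_cone.zero)
    next
      case False
      then have "a \<le> i" "i \<le> N" "b \<le> m - i" "m - i \<le> M" using assms(3,4) m i by auto
      then have "gamma_cone (i - a) (fps_nth f i)" "gamma_cone (m - i - b) (fps_nth g (m - i))"
        using assms(1,2) unfolding gamma_upto_def by blast+
      moreover have "m - (a + b) = (i - a) + (m - i - b)" using False i m by auto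
      ultimately show ?thesis using gamma_cone_mult by metis
    qed
  qed
qed

lemma gamma_cone_generators:
  "gamma_cone 2 (S_var * T_var)" "gamma_cone 1 (S_var + T_var)" "gamma_cone 1 (1 + S_var * T_var)" "gamma_cone 0 1"
proof -
  have one: "[:[:1:]:] = (1 :: real poly poly)" by (simp add: one_pCons)
  show "gamma_cone 2 (S_var * T_var)" using gamma_cone.basis[of 1 1 0 2] one by (simp add: gamma_basis_def)
  show "gamma_cone 1 (S_var + T_var)" using gamma_cone.basis[of 1 0 1 1] one by (simp add: gamma_basis_def)
  show "gamma_cone 1 (1 + S_var * T_var)" using gamma_cone.basis[of 1 0 0 1] one by (simp add: gamma_basis_def)
  show "gamma_cone 0 1" using gamma_cone.basis[of 1 0 0 0] one by (simp add: gamma_basis_def)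
qed

text \<open>Every further factor without constant term extends the known range by one.\<close>

lemma gamma_upto_power:
  assumes "gamma_upto 1 N f"
  shows "gamma_upto (Suc k) (N + k) (f ^ Suc k)"
proof (induction k)
  case 0
  then show ?case using assms by simp
next
  case (Suc k)
  have "gamma_upto (1 + Suc k) (N + Suc k) (f * f ^ Suc k)"
    by (rule gamma_upto_mult[OF assms Suc]) simp_all
  then show ?case by simp
qed

lemma gamma_upto_of_nat_mult: "gamma_upto a N f \<Longrightarrow> gamma_upto a N (of_nat k * f)"
proof (induction k)
  case 0
  then show ?case by (auto simp: gamma_upto_def intro: gamma_cone.zero)
next
  case (Suc k)
  then show ?case by (simp add: distrib_right gamma_upto_add)
qed

text \<open>Induction on \<open>N\<close>: the coefficient at \<open>Suc N\<close> of the right side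
  uses only those of \<open>F\<close> up to \<open>N\<close>, since \<open>F\<close> occurs there in
  powers at least 2 or multiplied by a series without constant term.\<close>

lemma gamma_upto_functional_equation:
  fixes F :: "real poly poly fps"
  defines "P \<equiv> fps_const (S_var * T_var)" and "Q \<equiv> fps_const (S_var + T_var)"
    and "R \<equiv> fps_const (1 + S_var * T_var)"
  assumes zero: "fps_nth F 0 = 0"
    and eq: "F = P * F ^ 3 + (1 + R * F + P * F ^ 2) * (fps_X + P * Q * F ^ 4 + 6 * (P ^ 2 * F ^ 5))"
  shows "gamma_upto 1 N F"
proof (induction N)
  case 0
  show ?case using zero by (simp add: gamma_upto_def)
next
  case (Suc N)
  note gen = gamma_cone_generators
  have pow: "gamma_upto (Suc k) (Suc N) (F ^ Suc k)" if "1 \<le> k" for k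
    using gamma_upto_mono[OF gamma_upto_power[OF Suc, of k]] that by simp
  have F2: "gamma_upto 2 (Suc N) (F ^ 2)" and F3: "gamma_upto 3 (Suc N) (F ^ 3)"
    and F4: "gamma_upto 4 (Suc N) (F ^ 4)" and F5: "gamma_upto 5 (Suc N) (F ^ 5)"
    using pow[of 1] pow[of 2] pow[of 3] pow[of 4] by (simp_all add: eval_nat_numeral)
  have PF3: "gamma_upto 1 (Suc N) (P * F ^ 3)"
    using gamma_upto_const_mult[OF F3 gen(1)] by (simp add: P_def)
  have "gamma_upto 1 (Suc N) (fps_const (S_var * T_var * (S_var + T_var)) * F ^ 4)"
    using gamma_upto_const_mult[OF F4 gamma_cone_mult[OF gen(1,2)]] by simp
  then have S4: "gamma_upto 1 (Suc N) (P * Q * F ^ 4)" by (simp add: P_def Q_def)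
  have "gamma_upto 1 (Suc N) (fps_const (S_var * T_var * (S_var * T_var)) * F ^ 5)"
    using gamma_upto_const_mult[OF F5 gamma_cone_mult[OF gen(1,1)]] by simp
  then have "gamma_upto 1 (Suc N) (P ^ 2 * F ^ 5)" by (simp add: P_def power2_eq_square)
  then have S5: "gamma_upto 1 (Suc N) (6 * (P ^ 2 * F ^ 5))"
    using gamma_upto_of_nat_mult[of 1 "Suc N" "P ^ 2 * F ^ 5" 6] by (simp only: of_nat_numeral)
  have X: "gamma_upto 1 (Suc N) fps_X"
    using gen(4) by (auto simp: gamma_upto_def fps_X_def intro: gamma_cone.zero)
  \<comment> \<open>Known only up to \<open>N\<close>, with offset 0; the other factor has no
    constant term, so the product is still controlled up to \<open>Suc N\<close>.\<close>
  have RF: "gamma_upto 0 N (R * F)" using gamma_upto_const_mult[OF Suc gen(3)] by (simp add: R_def)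
  have PF2: "gamma_upto 0 N (P * F ^ 2)"
    using gamma_upto_mono[OF gamma_upto_const_mult[OF F2 gen(1)]] by (simp add: P_def)
  have one: "gamma_upto 0 N 1"
    using gen(4) by (auto simp: gamma_upto_def intro: gamma_cone.zero)
  have "gamma_upto (0 + 1) (Suc N)
      ((1 + R * F + P * F ^ 2) * (fps_X + P * Q * F ^ 4 + 6 * (P ^ 2 * F ^ 5)))"
    by (rule gamma_upto_mult) (rule gamma_upto_add one RF PF2 X S4 S5 | simp)+
  then have "gamma_upto 1 (Suc N)
      (P * F ^ 3 + (1 + R * F + P * F ^ 2) * (fps_X + P * Q * F ^ 4 + 6 * (P ^ 2 * F ^ 5)))"
    by (intro gamma_upto_add PF3) (simp only: add_0)
  then show ?case by (simp only: eq[symmetric])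
qed

section \<open>The functional equation for \<open>H(5)\<close>\<close>

text \<open>An executable form of not being simple.\<close>

definition has_proper_block :: "nat list \<Rightarrow> bool" where
  "has_proper_block w \<longleftrightarrow>
    (\<exists>i\<in>set [0..<length w]. \<exists>m\<in>set [2..<length w]. \<exists>a\<in>set [1..<length w].
      i + m \<le> length w \<and> list_all (\<lambda>x. a \<le> x \<and> x < a + m) (take m (drop i w)))"

text \<open>\<open>m\<close> distinct entries in a window of \<open>m\<close> values fill it, so
  containment suffices as a test. A block with \<open>m \<ge> 2\<close> starts at a value below
  \<open>length w\<close>, which limits the search for \<open>a\<close>.\<close>

lemma simple_perm_iff_no_proper_block:
  assumes w: "w \<in> all_perms"
  shows "simple_perm w \<longleftrightarrow> \<not> has_proper_block w"
proof -
  have d: "distinct w" and s: "set w = {1..length w}" using w by (auto simp: all_perms_iff)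
  have card: "card (set (take m (drop i w))) = m" if "i + m \<le> length w" for i m
    using d that by (simp add: distinct_card)
  have "has_proper_block w \<longleftrightarrow> (\<exists>i m. is_block w i m \<and> m \<noteq> 1 \<and> m \<noteq> length w)"
  proof
    assume "has_proper_block w"
    then obtain i m a where im: "2 \<le> m" "m < length w" "i + m \<le> length w"
      and all: "list_all (\<lambda>x. a \<le> x \<and> x < a + m) (take m (drop i w))"
      by (auto simp: has_proper_block_def)
    have "set (take m (drop i w)) \<subseteq> {a..a + m - 1}" using all by (auto simp: list_all_iff)
    moreover have "card {a..a + m - 1} = m" using im by simp
    ultimately have "set (take m (drop i w)) = {a..a + m - 1}"
      using card[OF im(3)] by (intro card_subset_eq) auto
    then have "is_block w i m" using im unfolding is_block_def by auto
    then show "\<exists>i m. is_block w i m \<and> m \<noteq> 1 \<and> m \<noteq> length w" using im by (intro exI[of _ i] exI[of _ m]) simp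
  next
    assume "\<exists>i m. is_block w i m \<and> m \<noteq> 1 \<and> m \<noteq> length w"
    then obtain i m a b where im: "1 \<le> m" "i + m \<le> length w" "m \<noteq> 1" "m \<noteq> length w"
      and ab: "set (take m (drop i w)) = {a..b}" unfolding is_block_def by blast
    have m: "Suc b - a = m" using card[OF im(2)] unfolding ab by simp
    have "{a..b} \<subseteq> {1..length w}"
      unfolding ab[symmetric] s[symmetric] by (meson set_drop_subset set_take_subset subset_trans)
    moreover have "a \<le> b" using m im by linarith
    ultimately have "1 \<le> a" "b \<le> length w" by auto
    then have "i \<in> set [0..<length w]" "m \<in> set [2..<length w]" "a \<in> set [1..<length w]"
      using im m by auto
    moreover have "list_all (\<lambda>x. a \<le> x \<and> x < a + m) (take m (drop i w))"
      unfolding list_all_iff ab using m by auto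
    ultimately show "has_proper_block w" unfolding has_proper_block_def using im(2) by blast
  qed
  then show ?thesis using w by (auto simp: simple_perm_def)
qed

section \<open>The simple permutations of length 3 to 5 and their weights\<close>

definition long_simples :: "nat list list" where
  "long_simples = [[2, 4, 1, 3], [3, 1, 4, 2], [2, 4, 1, 5, 3], [2, 5, 3, 1, 4], [3, 1, 5, 2, 4],
    [3, 5, 1, 4, 2], [4, 1, 3, 5, 2], [4, 2, 5, 1, 3]]"

lemma long_simples_all_perms: "p \<in> set long_simples \<Longrightarrow> p \<in> all_perms"
proof -
  have "list_all (\<lambda>p. p \<noteq> [] \<and> distinct p \<and> set p = set [1..<Suc (length p)]) long_simples" by code_simp
  then show "p \<in> set long_simples \<Longrightarrow> p \<in> all_perms"
    by (auto simp: list_all_iff all_perms_iff atLeastLessThanSuc_atLeastAtMost simp del: upt_Suc)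
qed

text \<open>Exhaustive check over all permutations of length 3, 4 and 5; length 3 contributes
  none.\<close>

lemma Simp_le_5_long: "{p \<in> Simp_le 5. 3 \<le> length p} = set long_simples"
proof
  let ?ok = "\<lambda>w. has_proper_block w \<or> w \<in> set long_simples"
  have ok: "list_all ?ok (permutations_of_set_list [1, 2, 3])"
    "list_all ?ok (permutations_of_set_list [1, 2, 3, 4])"
    "list_all ?ok (permutations_of_set_list [1, 2, 3, 4, 5])" by code_simp+
  show "{p \<in> Simp_le 5. 3 \<le> length p} \<subseteq> set long_simples"
  proof
    fix p assume "p \<in> {p \<in> Simp_le 5. 3 \<le> length p}"
    then have p: "simple_perm p" "p \<in> all_perms" "length p \<in> {3, 4, 5}"
      by (auto simp: Simp_le_def simple_perm_def)
    have sets: "{1..3} = set [1, 2, 3 :: nat]" "{1..4} = set [1, 2, 3, 4 :: nat]"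
      "{1..5} = set [1, 2, 3, 4, 5 :: nat]" by auto
    have "p \<in> Sym (length p)" using p(2) unfolding all_perms_iff Sym_iff by blast
    then have "p \<in> Sym 3 \<or> p \<in> Sym 4 \<or> p \<in> Sym 5" using p(3) by auto
    then have "?ok p" using ok unfolding sets permutations_of_list list_all_iff by auto
    then show "p \<in> set long_simples" using p simple_perm_iff_no_proper_block by blast
  qed
  have "list_all (\<lambda>p. \<not> has_proper_block p \<and> 3 \<le> length p \<and> length p \<le> 5) long_simples" by code_simp
  then show "set long_simples \<subseteq> {p \<in> Simp_le 5. 3 \<le> length p}"
    using simple_perm_iff_no_proper_block long_simples_all_perms
    by (auto simp: list_all_iff Simp_le_def)
qed

text \<open>The last hypothesis says that \<open>v\<close> composed with \<open>w\<close> is the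
  identity, with value \<open>x\<close> looked up at index \<open>x - 1\<close>. Checking a proposed
  inverse avoids evaluating the definite description in \<open>inv_perm\<close>.\<close>

lemma inv_perm_eqI:
  assumes "w \<in> all_perms" "length v = length w" "map (\<lambda>x. v ! (x - 1)) w = [1..<Suc (length w)]"
  shows "inv_perm w = v"
proof (rule nth_equalityI)
  fix k assume "k < length (inv_perm w)"
  then have k: "k < length w" by simp
  have d: "distinct w" and s: "set w = {1..length w}" using assms(1) by (auto simp: all_perms_iff)
  have "Suc k \<in> set w" unfolding s using k by simp
  then obtain i where i: "i < length w" "w ! i = Suc k" by (metis in_set_conv_nth)
  have "v ! k = map (\<lambda>x. v ! (x - 1)) w ! i" using i by simp
  also have "\<dots> = Suc i" unfolding assms(3) using i(1) by (simp del: upt_Suc)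
  finally show "inv_perm w ! k = v ! k" using nth_inv_perm[OF d i k] by simp
qed (use assms(2) in simp)

abbreviation weight :: "nat list \<Rightarrow> real poly poly" where
  "weight w \<equiv> S_var ^ des w * T_var ^ ides w"

lemma weight_eqI:
  assumes "w \<in> all_perms" "length v = length w" "map (\<lambda>x. v ! (x - 1)) w = [1..<Suc (length w)]"
  shows "weight w = S_var ^ des w * T_var ^ des v"
  using inv_perm_eqI[OF assms] by (simp add: ides_def)

lemma weight_pairs: "weight [1, 2] = 1" "weight [2, 1] = S_var * T_var"
proof -
  have "[1, 2] \<in> all_perms" "[2, 1] \<in> all_perms" using pairs_simple by (auto simp: simple_perm_def)
  from weight_eqI[OF this(1), of "[1, 2]"] weight_eqI[OF this(2), of "[2, 1]"]
  show "weight [1, 2] = 1" "weight [2, 1] = S_var * T_var" by simp_all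
qed

lemma weight_singleton: "weight [1] = 1"
  using weight_eqI[of "[1]" "[1]"] by (simp add: all_perms_iff)

lemma weight_long_simples:
  "(\<Sum>p\<in>set long_simples. fps_const (weight p) * F ^ length p) =
    fps_const (S_var * T_var) * fps_const (S_var + T_var) * F ^ 4 + 6 * (fps_const (S_var * T_var) ^ 2 * F ^ 5)"
proof -
  \<comment> \<open>The list pairs each simple permutation with its inverse.\<close>
  have inv: "weight p = S_var ^ des p * T_var ^ des q"
    if "(p, q) \<in> set [([2, 4, 1, 3], [3, 1, 4, 2]), ([3, 1, 4, 2], [2, 4, 1, 3]),
      ([2, 4, 1, 5, 3], [3, 1, 5, 2, 4]), ([2, 5, 3, 1, 4], [4, 1, 3, 5, 2]), ([3, 1, 5, 2, 4], [2, 4, 1, 5, 3]),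
      ([3, 5, 1, 4, 2], [3, 5, 1, 4, 2]), ([4, 1, 3, 5, 2], [2, 5, 3, 1, 4]), ([4, 2, 5, 1, 3], [4, 2, 5, 1, 3])]"
      (is "_ \<in> set ?ps") for p q
  proof -
    have "list_all (\<lambda>(p, q). p \<in> set long_simples \<and> length q = length p \<and>
      map (\<lambda>x. q ! (x - 1)) p = [1..<Suc (length p)]) ?ps" by code_simp
    then show ?thesis using that by (intro weight_eqI long_simples_all_perms) (auto simp: list_all_iff simp del: upt_Suc)
  qed
  have w: "weight [2, 4, 1, 3] = S_var * T_var ^ 2" "weight [3, 1, 4, 2] = S_var ^ 2 * T_var"
    "weight [2, 4, 1, 5, 3] = (S_var * T_var) ^ 2" "weight [2, 5, 3, 1, 4] = (S_var * T_var) ^ 2"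
    "weight [3, 1, 5, 2, 4] = (S_var * T_var) ^ 2" "weight [3, 5, 1, 4, 2] = (S_var * T_var) ^ 2"
    "weight [4, 1, 3, 5, 2] = (S_var * T_var) ^ 2" "weight [4, 2, 5, 1, 3] = (S_var * T_var) ^ 2"
    using inv[of "[2, 4, 1, 3]" "[3, 1, 4, 2]"] inv[of "[3, 1, 4, 2]" "[2, 4, 1, 3]"]
      inv[of "[2, 4, 1, 5, 3]" "[3, 1, 5, 2, 4]"] inv[of "[2, 5, 3, 1, 4]" "[4, 1, 3, 5, 2]"]
      inv[of "[3, 1, 5, 2, 4]" "[2, 4, 1, 5, 3]"] inv[of "[3, 5, 1, 4, 2]" "[3, 5, 1, 4, 2]"]
      inv[of "[4, 1, 3, 5, 2]" "[2, 5, 3, 1, 4]"] inv[of "[4, 2, 5, 1, 3]" "[4, 2, 5, 1, 3]"]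
    by (simp_all add: power_mult_distrib power2_eq_square numeral_2_eq_2)
  have "distinct long_simples" by code_simp
  then have "(\<Sum>p\<in>set long_simples. fps_const (weight p) * F ^ length p) =
      (\<Sum>p\<leftarrow>long_simples. fps_const (weight p) * F ^ length p)"
    by (rule sum.distinct_set_conv_list)
  also have "\<dots> = (fps_const (S_var * T_var ^ 2) + fps_const (S_var ^ 2 * T_var)) * F ^ 4 +
      6 * (fps_const ((S_var * T_var) ^ 2) * F ^ 5)"
  proof -
    have "length [2, 4, 1, 3 :: nat] = 4" "length [3, 1, 4, 2 :: nat] = 4" "length [2, 4, 1, 5, 3 :: nat] = 5"
      "length [2, 5, 3, 1, 4 :: nat] = 5" "length [3, 1, 5, 2, 4 :: nat] = 5" "length [3, 5, 1, 4, 2 :: nat] = 5"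
      "length [4, 1, 3, 5, 2 :: nat] = 5" "length [4, 2, 5, 1, 3 :: nat] = 5" by simp_all
    note len = this
    \<comment> \<open>The six permutations of length 5 have equal weight, hence six copies of
      \<open>c\<close>; the final 0 is the sum of the empty list.\<close>
    have "a * x + (b * x + (c + (c + (c + (c + (c + (c + 0))))))) = (a + b) * x + 6 * c"
      for a b c x :: "real poly poly fps" by (simp add: distrib_right)
    then show ?thesis unfolding long_simples_def list.map sum_list.Cons sum_list.Nil w len .
  qed
  also have "fps_const (S_var * T_var ^ 2) + fps_const (S_var ^ 2 * T_var) =
      fps_const (S_var * T_var) * fps_const (S_var + T_var)"
    by (simp add: power2_eq_square algebra_simps)
  also have "fps_const ((S_var * T_var) ^ 2) = fps_const (S_var * T_var) ^ 2"
    by (simp add: power2_eq_square)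
  finally show ?thesis .
qed

section \<open>Decomposition classes and their generating functions\<close>

lemma in_listset_iff: "as \<in> listset As \<longleftrightarrow> list_all2 (\<in>) as As"
proof (induction As arbitrary: as)
  case (Cons A As)
  then show ?case by (cases as) (auto simp: set_Cons_def)
qed auto

lemma listsetD:
  assumes "as \<in> listset As" "\<And>A. A \<in> set As \<Longrightarrow> A \<subseteq> K"
  shows "length as = length As" "set as \<subseteq> K"
proof -
  have l: "list_all2 (\<in>) as As" using assms(1) unfolding in_listset_iff .
  then show len: "length as = length As" by (rule list_all2_lengthD)
  show "set as \<subseteq> K"
  proof
    fix a assume "a \<in> set as"
    then obtain i where i: "i < length As" "a = as ! i" using len by (metis in_set_conv_nth)
    then have "a \<in> As ! i" using list_all2_nthD2[OF l] by blast
    then show "a \<in> K" using assms(2)[OF nth_mem[OF i(1)]] by blast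
  qed
qed

lemma weight_inflate:
  assumes "length as = length p" "set as \<subseteq> all_perms" "p \<in> all_perms"
  shows "weight (inflate p as) = weight p * prod_list (map weight as)"
proof -
  have "prod_list (map weight as) = S_var ^ sum_list (map des as) * T_var ^ sum_list (map ides as)"
    by (induction as) (simp_all add: power_add)
  then show ?thesis
    using des_inflate[OF assms(1,2)] ides_inflate[OF assms] assms(3) by (simp add: all_perms_iff power_add)
qed

lemma finite_levels_all_perms: "finite_levels length all_perms"
  unfolding finite_levels_def
proof
  fix n
  have "{w. w \<in> all_perms \<and> length w = n} \<subseteq> Sym n" by (auto simp: all_perms_iff Sym_iff)
  then show "finite {w. w \<in> all_perms \<and> length w = n}" by (rule finite_subset) simp
qed

lemma gf_inflate:
  assumes p: "p \<in> all_perms" "length As = length p" and As: "\<And>A. A \<in> set As \<Longrightarrow> A \<subseteq> all_perms"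
    and inj: "inj_on (inflate p) (listset As)"
  shows "gf length weight (inflate p ` listset As) =
    fps_const (weight p) * prod_list (map (gf length weight) As)"
proof -
  have fin: "A \<in> set As \<Longrightarrow> finite_levels length A" for A
    using As finite_levels_subset[OF finite_levels_all_perms] by blast
  have "gf length weight (inflate p ` listset As) =
      fps_const (weight p) * gf (\<lambda>as. sum_list (map length as)) (\<lambda>as. prod_list (map weight as)) (listset As)"
  proof (rule gf_image[OF inj])
    fix as assume as: "as \<in> listset As"
    note asD = listsetD[OF as As]
    show "length (inflate p as) = sum_list (map length as)"
      using asD p(2) by (intro length_inflate) simp
    show "weight (inflate p as) = weight p * prod_list (map weight as)"
      using asD p by (intro weight_inflate) simp_all
  qed
  also have "gf (\<lambda>as. sum_list (map length as)) (\<lambda>as. prod_list (map weight as)) (listset As) =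
      prod_list (map (gf length weight) As)" by (rule gf_listset(2)[OF fin])
  finally show ?thesis .
qed

text \<open>The equations for \<open>A\<close> and \<open>B\<close> enter with their denominators
  cleared, as \<open>A'\<close> and \<open>B'\<close>, so the elimination works in any commutative
  ring.\<close>

lemma functional_equation_of_decomposition:
  fixes F A B S P X :: "'r :: comm_ring_1"
  assumes F: "F = X + (A + (B + S))" and A: "A = (F - A) * F" and B: "B = P * ((F - B) * F)"
  shows "F = P * F ^ 3 + (1 + (1 + P) * F + P * F ^ 2) * (X + S)"
proof -
  have A': "A * (1 + F) = F ^ 2" 
  proof -
    have "A * (1 + F) = (F - A) * F + A * F" by (subst A[symmetric]) (simp add: distrib_left)
    then show ?thesis by (simp add: algebra_simps power2_eq_square)
  qed
  have B': "B * (1 + P * F) = P * F ^ 2"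
  proof -
    have "B * (1 + P * F) = P * ((F - B) * F) + B * P * F"
      by (subst B[symmetric]) (simp add: algebra_simps)
    then show ?thesis by (simp add: algebra_simps power2_eq_square)
  qed
  have XS: "X + S = F - A - B" using F by (simp add: algebra_simps)
  have "(1 + (1 + P) * F + P * F ^ 2) * (X + S) =
      F * ((1 + F) * (1 + P * F)) - (A * (1 + F)) * (1 + P * F) - (B * (1 + P * F)) * (1 + F)"
    unfolding XS by (simp add: algebra_simps power2_eq_square)
  then show ?thesis unfolding A' B' by (simp add: algebra_simps power2_eq_square power3_eq_cube)
qed

text \<open>The existence half of the decomposition: a pattern of length 2 gives a sum or a skew
  sum, a longer one falls into the last union. Disjointness is proved separately.\<close>

lemma decs_eq_decomposition:
  assumes "2 \<le> n"
  shows "decs n = {[1]} \<union> ({w \<in> decs n. splits [1, 2] w} \<union> ({w \<in> decs n. splits [2, 1] w} \<union>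
    (\<Union>p\<in>{p \<in> Simp_le n. 3 \<le> length p}. inflate p ` listset (replicate (length p) (decs n)))))"
    (is "_ = ?one \<union> (?A \<union> (?B \<union> ?U))")
proof
  show "decs n \<subseteq> ?one \<union> (?A \<union> (?B \<union> ?U))"
  proof
    fix w assume w: "w \<in> decs n"
    show "w \<in> ?one \<union> (?A \<union> (?B \<union> ?U))"
    proof (cases "w = [1]")
      case False
      obtain p as where p: "p \<in> Simp_le n" "2 \<le> length p" "length as = length p" "set as \<subseteq> decs n"
        "w = inflate p as" using decs_cases[OF w False] .
      show ?thesis
      proof (cases "3 \<le> length p")
        case True
        have "as \<in> listset (replicate (length p) (decs n))"
          using p(3,4) by (auto simp: in_listset_iff list_all2_conv_all_nth)
        then show ?thesis using p True by blast
      next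
        case False
        then have l: "length p = 2" using p(2) by simp
        then have "p \<in> pairs" using all_perms_length2 p(1) Simp_le_all_perms by blast
        moreover obtain a b where "as = [a, b]" using p(3) l by (auto simp: length_Suc_conv numeral_2_eq_2)
        moreover from this have "a \<in> all_perms" "b \<in> all_perms" using p(4) by (auto simp: decs_def)
        ultimately have "splits [1, 2] w \<or> splits [2, 1] w" using p(5) unfolding splits_def by blast
        then show ?thesis using w by blast
      qed
    qed simp
  qed
  show "?one \<union> (?A \<union> (?B \<union> ?U)) \<subseteq> decs n"
  proof -
    have "inflate p as \<in> decs n" if "p \<in> Simp_le n" "as \<in> listset (replicate (length p) (decs n))" for p as
    proof (rule inflate_in_decs)
      show "p \<in> decs n" using that(1) Simp_le_subset_decs by blast
      show "length as = length p" "set as \<subseteq> decs n"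
        using listsetD[OF that(2), of "decs n"] by auto
    qed
    then show ?thesis using singleton_in_decs by blast
  qed
qed

lemma splits_length: "splits e w \<Longrightarrow> e \<in> pairs \<Longrightarrow> 2 \<le> length w"
proof -
  assume e: "e \<in> pairs" and "splits e w"
  then obtain a b where ab: "a \<in> all_perms" "b \<in> all_perms" "w = inflate e [a, b]" by (auto simp: splits_def)
  have "0 < length a" "0 < length b" using ab by (auto simp: all_perms_iff)
  then show "2 \<le> length w" using length_inflate_pair[OF e, of a b] unfolding ab(3) by linarith
qed

lemma not_splits_both: "splits [1, 2] w \<Longrightarrow> \<not> splits [2, 1] w"
  unfolding splits_def using inflate_pairs_neq by metis

text \<open>This separates inflations of long simple permutations from the singleton, from sums and
  skew sums, and from each other. The last fact also gives injectivity of inflation for a fixed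
  pattern.\<close>

lemma inflate_long_simple:
  assumes p: "p \<in> Simp_le n" "3 \<le> length p" and as: "as \<in> listset (replicate (length p) (decs n))"
  shows "inflate p as \<noteq> [1]" "e \<in> pairs \<Longrightarrow> \<not> splits e (inflate p as)"
    "q \<in> Simp_le n \<Longrightarrow> 3 \<le> length q \<Longrightarrow> bs \<in> listset (replicate (length q) (decs n)) \<Longrightarrow>
      inflate p as = inflate q bs \<Longrightarrow> p = q \<and> as = bs"
proof -
  have K: "decs n \<subseteq> all_perms" by (auto simp: decs_def)
  have L: "length as = length p \<and> set as \<subseteq> all_perms" if "as \<in> listset (replicate (length p) (decs n))" for p as
    using listsetD[OF that, of all_perms] K by auto
  have sp: "simple_perm p" using p(1) by (simp add: Simp_le_def)
  show "inflate p as \<noteq> [1]"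
  proof
    assume "inflate p as = [1]"
    moreover have p0: "0 < length p" and "2 \<le> length p" using p(2) by linarith+
    ultimately have "length (as ! 0) < length [1 :: nat]"
      using length_nth_less_inflate[of as p 0] L[OF as] by metis
    moreover have "as ! 0 \<noteq> []"
      using set_nth_all_perms(3)[of as 0] L[OF as] p0 by metis
    ultimately show False by simp
  qed
  show "\<not> splits e (inflate p as)" if e: "e \<in> pairs"
  proof
    assume "splits e (inflate p as)"
    then obtain a b where ab: "a \<in> all_perms" "b \<in> all_perms" "inflate p as = inflate e [a, b]"
      by (auto simp: splits_def)
    have le: "length e = 2" using e by auto
    have "p = e"
      by (rule inflate_simple_unique(1)[OF sp p(2) pairs_simple[OF e] _ _ _ _ _ ab(3)])
        (use L[OF as] ab le in simp_all)
    then show False using p(2) le by simp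
  qed
  show "p = q \<and> as = bs" if q: "q \<in> Simp_le n" "3 \<le> length q"
    and bs: "bs \<in> listset (replicate (length q) (decs n))" and eq: "inflate p as = inflate q bs"
  proof -
    have sq: "simple_perm q" "2 \<le> length q" using q by (simp_all add: Simp_le_def)
    note u = inflate_simple_unique[OF sp p(2) sq _ _ _ _ eq]
    show ?thesis using u L[OF as] L[OF bs] by blast
  qed
qed

lemma gf_decs_5_equation:
  defines "F \<equiv> gf length weight (decs 5)"
    and "P \<equiv> fps_const (S_var * T_var)" and "Q \<equiv> fps_const (S_var + T_var)"
  shows "F = P * F ^ 3 + (1 + (1 + P) * F + P * F ^ 2) * (fps_X + (P * Q * F ^ 4 + 6 * (P ^ 2 * F ^ 5)))"
proof -
  let ?K = "decs 5"
  let ?U = "\<lambda>p. inflate p ` listset (replicate (length p) ?K)"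
  let ?L = "{p \<in> Simp_le 5. 3 \<le> length p}"
  define A where "A e = {w \<in> ?K. splits e w}" for e
  have K: "?K \<subseteq> all_perms" by (auto simp: decs_def)
  have fin: "finite_levels length X" if "X \<subseteq> ?K" for X
    using finite_levels_subset[OF finite_levels_all_perms] that K by blast
  have dec: "?K = {[1]} \<union> (A [1, 2] \<union> (A [2, 1] \<union> (\<Union>p\<in>?L. ?U p)))"
    unfolding A_def by (rule decs_eq_decomposition) simp
  have finL: "finite ?L" unfolding Simp_le_5_long by simp
  have sub: "{[1]} \<subseteq> ?K" "A e \<subseteq> ?K" "(\<Union>p\<in>?L. ?U p) \<subseteq> ?K" "p \<in> ?L \<Longrightarrow> ?U p \<subseteq> ?K" for e p
    using dec A_def by blast+
  have one: "gf length weight {[1]} = fps_X"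
  proof (rule fps_ext)
    fix n
    have "{w. w \<in> {[1 :: nat]} \<and> length w = n} = (if n = 1 then {[1]} else {})" by auto
    then show "fps_nth (gf length weight {[1]}) n = fps_nth fps_X n"
      unfolding gf_nth using weight_singleton by simp
  qed
  have "gf length weight (A e) = fps_const (weight e) * ((F - gf length weight (A e)) * F)"
    if e: "e \<in> pairs" for e
  proof -
    \<comment> \<open>The allowed first components. Their generating function is \<open>F\<close>
      minus that of \<open>A e\<close>, so the equation closes without a further unknown.\<close>
    let ?N = "{w \<in> ?K. \<not> splits e w}"
    have "?K = A e \<union> ?N" "A e \<inter> ?N = {}" by (auto simp: A_def)
    then have N: "F = gf length weight (A e) + gf length weight ?N"
      unfolding F_def using gf_Un[of length "A e" ?N] fin[OF sub(2)] fin[of ?N] by auto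
    have im: "A e = inflate e ` listset [?N, ?K]"
      unfolding A_def by (rule splits_decs_eq_image[OF e]) simp
    have "gf length weight (A e) =
        fps_const (weight e) * prod_list (map (gf length weight) [?N, ?K])"
      unfolding im
      by (rule gf_inflate) (use e K pairs_simple[OF e] inj_on_inflate_pair[OF e] in \<open>auto simp: simple_perm_def\<close>)
    moreover have "gf length weight ?N = F - gf length weight (A e)" using N by (simp add: algebra_simps)
    ultimately show ?thesis by (simp add: F_def)
  qed
  from this[of "[1, 2]"] this[of "[2, 1]"]
  have A12: "gf length weight (A [1, 2]) = (F - gf length weight (A [1, 2])) * F"
    and A21: "gf length weight (A [2, 1]) = P * ((F - gf length weight (A [2, 1])) * F)"
    unfolding weight_pairs P_def fps_const_1_eq_1 mult_1_left by blast+
  have U: "gf length weight (\<Union>p\<in>?L. ?U p) = P * Q * F ^ 4 + 6 * (P ^ 2 * F ^ 5)"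
  proof -
    have "gf length weight (\<Union>p\<in>?L. ?U p) = (\<Sum>p\<in>?L. gf length weight (?U p))"
    proof (rule gf_UN[OF finL])
      show "finite_levels length (?U p)" if "p \<in> ?L" for p using fin[OF sub(4)[OF that]] .
      show "?U p \<inter> ?U q = {}" if "p \<in> ?L" "q \<in> ?L" "p \<noteq> q" for p q
        using inflate_long_simple(3)[of p 5 _ q] that by blast
    qed
    also have "\<dots> = (\<Sum>p\<in>?L. fps_const (weight p) * F ^ length p)"
    proof (rule sum.cong[OF refl])
      fix p assume p: "p \<in> ?L"
      have "gf length weight (?U p) =
          fps_const (weight p) * prod_list (map (gf length weight) (replicate (length p) ?K))"
      proof (rule gf_inflate)
        show "p \<in> all_perms" using p Simp_le_all_perms by blast
        show "inj_on (inflate p) (listset (replicate (length p) ?K))"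
          using inflate_long_simple(3)[of p 5 _ p] p by (intro inj_onI) blast
      qed (use K in auto)
      then show "gf length weight (?U p) = fps_const (weight p) * F ^ length p"
        by (simp add: F_def prod_list_replicate)
    qed
    also have "\<dots> = P * Q * F ^ 4 + 6 * (P ^ 2 * F ^ 5)"
      unfolding Simp_le_5_long P_def Q_def by (rule weight_long_simples)
    finally show ?thesis .
  qed
  have "F = gf length weight {[1]} + (gf length weight (A [1, 2]) +
      (gf length weight (A [2, 1]) + gf length weight (\<Union>p\<in>?L. ?U p)))"
  proof -
    have d1: "A [2, 1] \<inter> (\<Union>p\<in>?L. ?U p) = {}" and d2: "A [1, 2] \<inter> (A [2, 1] \<union> (\<Union>p\<in>?L. ?U p)) = {}"
      using inflate_long_simple(2)[of _ 5] not_splits_both by (auto simp: A_def simp del: One_nat_def)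
    have d3: "{[1]} \<inter> (A [1, 2] \<union> (A [2, 1] \<union> (\<Union>p\<in>?L. ?U p))) = {}"
    proof -
      have "[1] \<notin> A e" if "e \<in> pairs" for e
        using splits_length[of e "[1]"] that by (auto simp: A_def)
      moreover have "[1] \<notin> ?U p" if "p \<in> ?L" for p
        using inflate_long_simple(1)[of p 5] that by (metis (no_types, lifting) imageE mem_Collect_eq)
      ultimately show ?thesis by blast
    qed
    have f1: "finite_levels length {[1 :: nat]}" and fA: "finite_levels length (A e)"
      and fU: "finite_levels length (\<Union>p\<in>?L. ?U p)" for e
      using fin[OF sub(1)] fin[OF sub(2)] fin[OF sub(3)] by simp_all
    have f2: "finite_levels length (A [2, 1] \<union> (\<Union>p\<in>?L. ?U p))"
      and f3: "finite_levels length (A [1, 2] \<union> (A [2, 1] \<union> (\<Union>p\<in>?L. ?U p)))"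
      using fin[OF Un_least[OF sub(2) sub(3)]] fin[OF Un_least[OF sub(2) Un_least[OF sub(2) sub(3)]]] by simp_all
    have "F = gf length weight ({[1]} \<union> (A [1, 2] \<union> (A [2, 1] \<union> (\<Union>p\<in>?L. ?U p))))"
      unfolding F_def by (rule arg_cong[OF dec])
    then show ?thesis unfolding gf_Un[OF f1 f3 d3] gf_Un[OF fA f2 d2] gf_Un[OF fA fU d1] .
  qed
  from functional_equation_of_decomposition[OF this A12 A21]
  show ?thesis unfolding one U .
qed

theorem theorem3p12:
  fixes n :: nat
  assumes "n \<ge> 1"
  shows "gamma_positive (n - 1) (\<Sum>\<sigma>\<in>H 5 \<inter> Sym n. S_var ^ des \<sigma> * T_var ^ ides \<sigma>)"
proof -
  let ?F = "gf length weight (decs 5)"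
  have "fps_nth ?F 0 = 0" by (auto simp: gf_nth decs_def all_perms_iff intro!: sum.neutral)
  \<comment> \<open>Matches the factor \<open>1 + P\<close> from the elimination with the generator
    \<open>1 + S_var * T_var\<close> of darga 1.\<close>
  moreover have "fps_const (1 + S_var * T_var) = 1 + fps_const (S_var * T_var)"
    by (metis fps_const_1_eq_1 fps_const_add)
  ultimately have "gamma_upto 1 n ?F"
    using gf_decs_5_equation by (intro gamma_upto_functional_equation) (simp_all only: add.assoc)
  then have "gamma_cone (n - 1) (fps_nth ?F n)" using assms by (simp add: gamma_upto_def)
  moreover have "{w. w \<in> decs 5 \<and> length w = n} = H 5 \<inter> Sym n"
    using all_perms_in_Sym_iff[OF assms] by (auto simp: H_eq_decs decs_def)
  ultimately show ?thesis using gamma_positive_gamma_cone by (simp add: gf_nth)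
qed

end
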